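(* Let $n\ge 3$ and $k\ge 1$ be integers and let $T(n,k)$ be the tadpole graph. Then $\gamma_{\rm SMB}(T(n,k))=\infty$ and $$\gamma'_{\rm SMB}(T(n,k))=\begin{cases}\lceil \log_2(n+k+\sigma(n))\rceil & \text{if } n \text{ is even and } k \text{ is odd},\\ \infty & \text{otherwise},\end{cases}$$ where $\sigma(n)=\frac{2^{\lceil \log_2 n\rceil}-n}{2}+1$.
   Context: The tadpole graph $T(n,k)$ ($n\ge 3$, $k\ge1$) is obtained from an $n$-cycle $v_0v_1\dots v_{n-1}v_0$ and a vertex-disjoint path $u_1\dots u_k$ by adding the edge $v_0u_k$. All graphs are finite and simple; $N_G[v]$ is the closed neighborhood of $v$. The Maker-Breaker domination game on a graph $G$ is played by Dominator and Staller, who alternately play a vertex not played before. Dominator wins if the set of vertices he has played is a dominating set of $G$; Staller wins if she has played all vertices of $N_G[v]$ for some $v\in V(G)$. In the D-game Dominator moves first, in the S-game Staller moves first. $\gamma_{\rm SMB}(G)$ (resp. $\gamma'_{\rm SMB}(G)$) is the smallest integer $k$ such that in the D-game (resp. S-game), under any strategy of Dominator, Staller can win having played at most $k$ vertices; the value is $\infty$ if Staller has no winning strategy. *)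

theory Defs
  imports Complex_Main "HOL-Library.Extended_Nat" "Graph_Theory.Pair_Digraph"
begin

text \<open>
  Finite simple graphs are rendered as in the library locale \<^locale>\<open>pair_graph\<close>:
  finite, loop-free digraphs with a symmetric set of arcs, where the edge \<open>uv\<close> is the pair of
  arcs \<open>(u, v)\<close>, \<open>(v, u)\<close>.
\<close>

subsection \<open>Domination\<close>

definition closed_nbhd :: "'a pair_pre_digraph \<Rightarrow> 'a \<Rightarrow> 'a set" where
  "closed_nbhd G v = insert v {u. (v, u) \<in> parcs G}"

definition dominating_set :: "'a pair_pre_digraph \<Rightarrow> 'a set \<Rightarrow> bool" where
  "dominating_set G D \<longleftrightarrow>
     D \<subseteq> pverts G \<and> (\<forall>v\<in>pverts G. v \<in> D \<or> (\<exists>u\<in>D. (u, v) \<in> parcs G))"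

subsection \<open>The Maker-Breaker domination game\<close>

datatype player = Dominator | Staller

fun opponent :: "player \<Rightarrow> player" where
  "opponent Dominator = Staller"
| "opponent Staller = Dominator"

text \<open>\<open>mover first i\<close> makes the move with index \<open>i\<close> (counted from \<open>0\<close>) if \<open>first\<close> begins.\<close>

definition mover :: "player \<Rightarrow> nat \<Rightarrow> player" where
  "mover first i = (if even i then first else opponent first)"

text \<open>A history lists the vertices played so far, in order of play.\<close>

definition played_by :: "player \<Rightarrow> player \<Rightarrow> 'a list \<Rightarrow> 'a set" where
  "played_by p first h = {h ! i | i. i < length h \<and> mover first i = p}"

definition dominator_won :: "'a pair_pre_digraph \<Rightarrow> player \<Rightarrow> 'a list \<Rightarrow> bool" where
  "dominator_won G first h \<longleftrightarrow> dominating_set G (played_by Dominator first h)"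

definition staller_won :: "'a pair_pre_digraph \<Rightarrow> player \<Rightarrow> 'a list \<Rightarrow> bool" where
  "staller_won G first h \<longleftrightarrow>
     (\<exists>v\<in>pverts G. closed_nbhd G v \<subseteq> played_by Staller first h)"

type_synonym 'a strategy = "'a list \<Rightarrow> 'a"

definition legal_strategy :: "'a pair_pre_digraph \<Rightarrow> 'a strategy \<Rightarrow> bool" where
  "legal_strategy G s \<longleftrightarrow>
     (\<forall>h. distinct h \<and> set h \<subset> pverts G \<longrightarrow> s h \<in> pverts G - set h)"

text \<open>The history after \<open>m\<close> moves if Dominator follows \<open>d\<close> and Staller follows \<open>s\<close>.\<close>

primrec play :: "player \<Rightarrow> 'a strategy \<Rightarrow> 'a strategy \<Rightarrow> nat \<Rightarrow> 'a list" where
  "play first d s 0 = []"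
| "play first d s (Suc m) =
     (let h = play first d s m
      in h @ [case mover first m of Dominator \<Rightarrow> d h | Staller \<Rightarrow> s h])"

text \<open>
  Staller has a strategy with which, whatever strategy Dominator uses, she wins having played at
  most \<open>k\<close> vertices. Plays run formally until all vertices are taken; stopping them at the
  first win would change nothing, since \<open>staller_won\<close> and \<open>dominator_won\<close> persist and exclude
  each other (\<open>not_both_won\<close> below).
\<close>

definition staller_wins_within ::
    "player \<Rightarrow> 'a pair_pre_digraph \<Rightarrow> nat \<Rightarrow> bool" where
  "staller_wins_within first G k \<longleftrightarrow>
     (\<exists>s. legal_strategy G s \<and>
        (\<forall>d. legal_strategy G d \<longrightarrow>
           (\<exists>m\<le>card (pverts G).
              staller_won G first (play first d s m) \<and>
              card (played_by Staller first (play first d s m)) \<le> k)))"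

text \<open>In \<^typ>\<open>enat\<close> the infimum of the empty set is \<open>\<infinity>\<close>.\<close>

definition SMB_number :: "player \<Rightarrow> 'a pair_pre_digraph \<Rightarrow> enat" where
  "SMB_number first G = Inf {enat k | k. staller_wins_within first G k}"

definition gamma_SMB :: "'a pair_pre_digraph \<Rightarrow> enat" where
  "gamma_SMB G = SMB_number Dominator G"

definition gamma_SMB' :: "'a pair_pre_digraph \<Rightarrow> enat" where
  "gamma_SMB' G = SMB_number Staller G"

lemma played_by_disjoint:
  assumes "distinct h"
  shows "played_by Dominator first h \<inter> played_by Staller first h = {}"
proof -
  have False
    if "i < length h" "j < length h" "h ! i = h ! j"
      "mover first i = Dominator" "mover first j = Staller" for i j
  proof -
    have "i = j" using that(1-3) assms nth_eq_iff_index_eq by blast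
    then show False using that by simp
  qed
  then show ?thesis by (fastforce simp: played_by_def)
qed

lemma not_both_won:
  assumes "pair_graph G" "distinct h"
  shows "\<not> (staller_won G first h \<and> dominator_won G first h)"
proof
  assume won: "staller_won G first h \<and> dominator_won G first h"
  interpret pair_graph G by fact
  from won obtain v where v: "v \<in> pverts G" "closed_nbhd G v \<subseteq> played_by Staller first h"
    by (auto simp: staller_won_def)
  have sym: "(u, v) \<in> parcs G \<Longrightarrow> (v, u) \<in> parcs G" for u
    using pair_sym_arcs by (auto simp: symmetric_def sym_def)
  have "v \<in> played_by Dominator first h \<or>
      (\<exists>u \<in> played_by Dominator first h. (u, v) \<in> parcs G)"
    using won v(1) by (simp add: dominator_won_def dominating_set_def)
  then have "closed_nbhd G v \<inter> played_by Dominator first h \<noteq> {}"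
    using sym by (auto simp: closed_nbhd_def)
  then show False using v(2) played_by_disjoint[OF assms(2), of first] by blast
qed

subsection \<open>Tadpole graphs\<close>

datatype tadpole_vertex = V nat | U nat

definition tadpole_edges :: "nat \<Rightarrow> nat \<Rightarrow> tadpole_vertex rel" where
  "tadpole_edges n k =
     {(V i, V ((i + 1) mod n)) | i. i < n} \<union>
     {(U j, U (j + 1)) | j. 1 \<le> j \<and> j < k} \<union>
     {(V 0, U k)}"

definition tadpole :: "nat \<Rightarrow> nat \<Rightarrow> tadpole_vertex pair_pre_digraph" where
  "tadpole n k =
     \<lparr> pverts = V ` {0..<n} \<union> U ` {1..k},
       parcs = tadpole_edges n k \<union> (tadpole_edges n k)\<inverse> \<rparr>"

lemma pair_graph_tadpole:
  assumes "n \<ge> 3" "k \<ge> 1"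
  shows "pair_graph (tadpole n k)"
proof -
  have sub: "parcs (tadpole n k) \<subseteq> pverts (tadpole n k) \<times> pverts (tadpole n k)"
    using assms by (auto simp: tadpole_def tadpole_edges_def)
  have fin: "finite (pverts (tadpole n k))"
    by (simp add: tadpole_def)
  have neq: "(i + 1) mod n \<noteq> i" if "i < n" for i
    using that assms by (cases "i + 1 = n") auto
  have wf: "pair_wf_digraph (tadpole n k)"
    using sub by unfold_locales auto
  have loopfree: "fst e \<noteq> snd e" if "e \<in> parcs (tadpole n k)" for e
    using that neq by (force simp: tadpole_def tadpole_edges_def)
  have "symmetric (with_proj (tadpole n k))"
    unfolding symmetric_def
    by (auto simp: sym_def arcs_ends_def arc_to_ends_def with_proj_def tadpole_def)
  then show ?thesis
    using sub fin loopfree finite_subset[OF sub]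
    by unfold_locales auto
qed

definition tadpole_sigma :: "nat \<Rightarrow> real" where
  "tadpole_sigma n = (2 ^ nat \<lceil>log 2 (real n)\<rceil> - real n) / 2 + 1"

end

theory Submission
  imports Defs
begin

text \<open>
  If the graph minus \<open>x\<close> has a perfect matching, Dominator survives Staller's move on \<open>x\<close> by
  taking a neighbour of \<open>x\<close> and pairing from then on. Pairing also wins the D-game after the first
  move \<open>V 0\<close>, and the S-game for all parities but \<open>n\<close> even, \<open>k\<close> odd (for \<open>n\<close> odd, \<open>k\<close> even he
  treats the tail and the cycle separately).

  In the remaining case every useful move of Staller cuts the graph into two parts, each of which
  she would win moving first; Dominator neutralises one of them and the game goes on in the other.
  On a path with \<open>2 C - 1\<close> vertices this halves \<open>C\<close> in each round, which yields
  \<open>\<lceil>log 2 (2 C)\<rceil>\<close> moves. For the tadpole with \<open>n = 2 A\<close>, \<open>k = 2 B - 1\<close> and \<open>2 ^ c\<close> the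
  least power of two with \<open>A \<le> 2 ^ c\<close>, Staller wins within \<open>t\<close> moves iff \<open>A + 2 ^ c + 2 B \<le> 2 ^ t\<close>,
  the left side being \<open>n + k + \<sigma>(n)\<close>.
\<close>

subsection \<open>Residual positions\<close>

text \<open>
  A position is represented by the edges that Dominator has not hit, with Staller's vertices
  removed. A move on a vertex outside all edges is a pass; allowing passes is harmless, since an
  additional vertex never hurts the player who owns it.
\<close>

definition residual :: "'a \<Rightarrow> 'a \<Rightarrow> 'a set set \<Rightarrow> 'a set set" where
  "residual x y F = {e \<in> (\<lambda>e. e - {x}) ` F. y \<notin> e}"

lemma residualI: "e \<in> F \<Longrightarrow> y \<notin> e - {x} \<Longrightarrow> e - {x} \<in> residual x y F"
  by (auto simp: residual_def)

text \<open>One round is a move \<open>x\<close> of Staller followed by a move \<open>y\<close> of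
  Dominator, so \<open>t\<close> counts Staller's moves only. The choice \<open>y = x\<close> is a
  pass by Dominator, since \<open>x\<close> is already deleted.\<close>

primrec win :: "nat \<Rightarrow> 'a set set \<Rightarrow> bool" where
  "win 0 F \<longleftrightarrow> {} \<in> F"
| "win (Suc t) F \<longleftrightarrow> (\<exists>x. \<forall>y. win t (residual x y F))"

text \<open>Staller repeats her moves: every edge that survives from \<open>F\<close> contains one
  that survives from \<open>F'\<close>. So edges may be shrunk or added in her favour.\<close>

lemma win_mono:
  assumes "win t F" "\<And>e. e \<in> F \<Longrightarrow> \<exists>e'\<in>F'. e' \<subseteq> e"
  shows "win t F'"
  using assms
proof (induction t arbitrary: F F')
  case 0
  then show ?case by fastforce
next
  case (Suc t)
  then obtain x where x: "\<And>y. win t (residual x y F)" by auto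
  have "win t (residual x y F')" for y
  proof (rule Suc.IH[OF x[of y]])
    fix e assume "e \<in> residual x y F"
    then obtain e0 where e0: "e0 \<in> F" "e = e0 - {x}" "y \<notin> e" by (auto simp: residual_def)
    then obtain e' where "e' \<in> F'" "e' \<subseteq> e0" using Suc.prems(2) by blast
    then have "e' - {x} \<in> residual x y F'" "e' - {x} \<subseteq> e" using e0 by (auto simp: residual_def)
    then show "\<exists>e'\<in>residual x y F'. e' \<subseteq> e" by blast
  qed
  then show ?case by auto
qed

lemma win_empty_edge: "{} \<in> F \<Longrightarrow> win t F"
proof (induction t arbitrary: F)
  case (Suc t)
  have "{} - {x} \<in> residual x y F" for x y using Suc.prems by (rule residualI) simp
  then show ?case using Suc.IH by simp
qed simp

lemma not_win_empty [simp]: "\<not> win t {}"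
  by (induction t) (auto simp: residual_def)

lemma win_only_empty_edge:
  assumes "win t F" "\<And>e. e \<in> F \<Longrightarrow> e = {}"
  shows "{} \<in> F"
proof -
  have "F \<noteq> {}" using assms(1) by auto
  then show ?thesis using assms(2) by blast
qed

lemma win_Suc: "win t F \<Longrightarrow> win (Suc t) F"
proof (induction t arbitrary: F)
  case 0
  then show ?case using win_empty_edge by (metis win.simps(1))
next
  case (Suc t)
  then show ?case by (metis win.simps(2))
qed

lemma win_le: "win t F \<Longrightarrow> t \<le> t' \<Longrightarrow> win t' F"
  by (induction t') (auto simp only: le_Suc_eq win_Suc le_zero_eq)

lemma residual_pass:
  assumes "x \<notin> \<Union>F"
  shows "residual x x F = F"
proof -
  have "e - {x} = e" if "e \<in> F" for e using assms that by blast
  then have "(\<lambda>e. e - {x}) ` F = F" by simp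
  then show ?thesis using assms by (auto simp: residual_def)
qed

text \<open>Staller takes \<open>r\<close>; Dominator can block only one of the singletons
  \<open>{p}\<close> and \<open>{q}\<close> left behind, and she takes the other.\<close>

lemma win_double_threat:
  assumes "{r, p} \<in> F" "{r, q} \<in> F" "p \<noteq> q" "r \<noteq> p" "r \<noteq> q"
  shows "win 2 F"
proof -
  have "win 1 (residual r y F)" for y
  proof -
    obtain z where z: "z \<in> {p, q}" "z \<noteq> y" using assms(3) by (cases "y = p") auto
    have "{r, z} \<in> F" using z(1) assms(1,2) by auto
    then have "{r, z} - {r} \<in> residual r y F" by (rule residualI) (use z(2) in auto)
    moreover have "{r, z} - {r} = {z}" using z(1) assms(4,5) by auto
    ultimately have "{z} - {z} \<in> residual z y' (residual r y F)" for y'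
      by (intro residualI) auto
    then show ?thesis by (auto intro!: exI[of _ z])
  qed
  then show ?thesis by (auto simp: numeral_2_eq_2)
qed

text \<open>Dominator answers a move on one of \<open>p\<close>, \<open>q\<close> with the other.\<close>

lemma win_pair:
  assumes "win t (insert {p, q} F)" "p \<notin> \<Union>F" "q \<notin> \<Union>F" "p \<noteq> q"
  shows "win t F"
  using assms
proof (induction t arbitrary: F)
  case 0
  then show ?case by auto
next
  case (Suc t)
  then obtain x where x: "\<And>y. win t (residual x y (insert {p, q} F))" by auto
  show ?case
  proof (cases "x \<in> {p, q}")
    case True
    \<comment> \<open>The reply \<open>y\<close> on the other vertex kills \<open>{p, q}\<close> and
      leaves \<open>F\<close> intact, so the round only costs Staller one move.\<close>
    then obtain y where y: "{p, q} = {x, y}" "x \<noteq> y" using Suc.prems(4) by (cases "x = p") auto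
    have "win t F"
    proof (rule win_mono[OF x[of y]])
      fix e assume "e \<in> residual x y (insert {p, q} F)"
      then obtain e0 where e0: "e0 = {x, y} \<or> e0 \<in> F" "e = e0 - {x}" "y \<notin> e"
        unfolding y(1) residual_def by auto
      then have "e0 \<in> F" using y(2) by auto
      moreover have "x \<in> {p, q}" using y(1) by simp
      then have "x \<notin> \<Union>F" using Suc.prems(2,3) by auto
      ultimately show "\<exists>e'\<in>F. e' \<subseteq> e" using e0(2) by blast
    qed
    then show ?thesis by (rule win_Suc)
  next
    case False
    have "win t (residual x y F)" for y
    proof (rule Suc.IH)
      show "win t (insert {p, q} (residual x y F))"
      proof (rule win_mono[OF x[of y]])
        fix e assume "e \<in> residual x y (insert {p, q} F)"
        then show "\<exists>e'\<in>insert {p, q} (residual x y F). e' \<subseteq> e"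
          using False by (auto simp: residual_def)
      qed
    qed (use Suc.prems in \<open>auto simp: residual_def\<close>)
    then show ?thesis by auto
  qed
qed

text \<open>Staller wins with at most \<open>t\<close> further moves of her own when \<open>p\<close> is to move.\<close>

definition pos :: "player \<Rightarrow> nat \<Rightarrow> 'a set set \<Rightarrow> bool" where
  "pos p t F \<longleftrightarrow> (case p of Staller \<Rightarrow> win t F | Dominator \<Rightarrow> \<forall>y. win t {e \<in> F. y \<notin> e})"

lemma pos_simps:
  "pos Staller t F \<longleftrightarrow> win t F"
  "pos Dominator t F \<longleftrightarrow> (\<forall>y. win t {e \<in> F. y \<notin> e})"
  by (simp_all add: pos_def)

lemma pos_mono:
  assumes "pos p t F" "\<And>e. e \<in> F \<Longrightarrow> \<exists>e'\<in>F'. e' \<subseteq> e"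
  shows "pos p t F'"
proof (cases p)
  case Dominator
  have "win t {e \<in> F'. y \<notin> e}" for y
  proof (rule win_mono[of t "{e \<in> F. y \<notin> e}"])
    fix e assume "e \<in> {e \<in> F. y \<notin> e}"
    then show "\<exists>e'\<in>{e \<in> F'. y \<notin> e}. e' \<subseteq> e" using assms(2)[of e] by blast
  qed (use assms(1) Dominator in \<open>simp add: pos_simps\<close>)
  then show ?thesis using Dominator by (simp add: pos_simps)
next
  case Staller
  then show ?thesis using assms win_mono by (metis pos_simps(1))
qed

lemma pos_Staller_Suc: "pos Staller (Suc t) F \<longleftrightarrow> (\<exists>x. pos Dominator t ((\<lambda>e. e - {x}) ` F))"
  by (simp add: pos_simps residual_def)

subsection \<open>Strategies and positions\<close>

definition live_edges :: "'a set set \<Rightarrow> player \<Rightarrow> 'a list \<Rightarrow> 'a set set" where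
  "live_edges E first h =
     (\<lambda>e. e - played_by Staller first h) ` {e \<in> E. e \<inter> played_by Dominator first h = {}}"

lemma played_by_Nil [simp]: "played_by p first [] = {}"
  by (simp add: played_by_def)

lemma played_by_snoc:
  "played_by p first (h @ [x]) =
     (if mover first (length h) = p then insert x (played_by p first h) else played_by p first h)"
proof -
  have "played_by p first (h @ [x]) = (!) (h @ [x]) ` {i. i < Suc (length h) \<and> mover first i = p}"
    unfolding played_by_def by auto
  also have "{i. i < Suc (length h) \<and> mover first i = p} =
      {i. i < length h \<and> mover first i = p} \<union> (if mover first (length h) = p then {length h} else {})"
    by (auto simp: less_Suc_eq)
  also have "(!) (h @ [x]) ` \<dots> = (!) (h @ [x]) ` {i. i < length h \<and> mover first i = p} \<union>
      (if mover first (length h) = p then {x} else {})"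
    by simp
  also have "(!) (h @ [x]) ` {i. i < length h \<and> mover first i = p} =
      (!) h ` {i. i < length h \<and> mover first i = p}"
    by (rule image_cong) (auto simp: nth_append)
  also have "\<dots> = played_by p first h"
    unfolding played_by_def by auto
  finally show ?thesis by auto
qed

lemma played_by_Un: "played_by Staller first h \<union> played_by Dominator first h = set h"
proof -
  have "mover first i = Staller \<or> mover first i = Dominator" for i
    by (cases "mover first i") auto
  then show ?thesis unfolding played_by_def set_conv_nth by blast
qed

lemma finite_played_by [simp]: "finite (played_by p first h)"
  unfolding played_by_def by (rule finite_subset[of _ "set h"]) auto

lemma live_edges_Nil [simp]: "live_edges E first [] = E"
  by (simp add: live_edges_def)

lemma live_edges_staller_move:
  assumes "mover first (length h) = Staller"
  shows "live_edges E first (h @ [x]) = (\<lambda>e. e - {x}) ` live_edges E first h"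
proof -
  have "e - insert x A = e - A - {x}" for e A :: "'a set" by blast
  then show ?thesis using assms by (simp add: live_edges_def played_by_snoc image_image)
qed

lemma live_edges_dominator_move:
  assumes "mover first (length h) = Dominator" "x \<notin> set h"
  shows "live_edges E first (h @ [x]) = {e \<in> live_edges E first h. x \<notin> e}"
proof -
  let ?S = "played_by Staller first h"
  have "x \<notin> ?S" using assms(2) played_by_Un[of first h] by blast
  then have "{e \<in> (\<lambda>e. e - ?S) ` F. x \<notin> e} = (\<lambda>e. e - ?S) ` {e \<in> F. x \<notin> e}" for F
    by blast
  then show ?thesis using assms(1) unfolding live_edges_def played_by_snoc
    by (simp add: conj_ac)
qed

lemma live_edges_disjoint: "e \<in> live_edges E first h \<Longrightarrow> e \<inter> set h = {}"
  using played_by_Un[of first h] by (auto simp: live_edges_def)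

lemma mover_Suc: "mover first (Suc m) = opponent (mover first m)"
  by (cases first) (auto simp: mover_def)

text \<open>In a history without repetition the players own disjoint sets, so a neighbourhood filled
  by Staller is unhit by Dominator and survives as an empty edge.\<close>

lemma staller_won_iff:
  assumes "distinct h"
  shows "staller_won G first h \<longleftrightarrow> {} \<in> live_edges (closed_nbhd G ` pverts G) first h"
proof -
  let ?S = "played_by Staller first h" and ?D = "played_by Dominator first h"
  have "closed_nbhd G v \<subseteq> ?S \<longleftrightarrow> closed_nbhd G v \<inter> ?D = {} \<and> {} = closed_nbhd G v - ?S" for v
    using played_by_disjoint[OF assms, of first] by auto
  then show ?thesis
    unfolding staller_won_def live_edges_def by (simp add: image_iff Bex_def) blast
qed

section \<open>Plays and their correspondence with residual positions\<close>

lemma length_play [simp]: "length (play first d s m) = m"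
  by (induction m) (auto simp: Let_def)

lemma play_legal:
  assumes "legal_strategy G d" "legal_strategy G s" "finite (pverts G)" "m \<le> card (pverts G)"
  shows "distinct (play first d s m) \<and> set (play first d s m) \<subseteq> pverts G"
  using assms(4)
proof (induction m)
  case 0
  then show ?case by simp
next
  case (Suc m)
  let ?h = "play first d s m"
  have h: "distinct ?h" "set ?h \<subseteq> pverts G" using Suc by auto
  have "card (set ?h) = m" using h(1) by (simp add: distinct_card)
  then have "set ?h \<subset> pverts G" using h(2) Suc.prems by auto
  then have "d ?h \<in> pverts G - set ?h" "s ?h \<in> pverts G - set ?h"
    using assms(1,2) h(1) by (auto simp: legal_strategy_def)
  then show ?case using h by (auto simp: Let_def split: player.split)
qed

text \<open>A winning move of the residual game may be illegal in the real one. It then lies in no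
  live edge and acts as a pass, and any free vertex \<open>z\<close> serves at least as
  well.\<close>

lemma pos_staller_step:
  assumes "pos Staller (Suc r) (live_edges E first h)" "mover first (length h) = Staller"
    and "\<Union>E \<subseteq> X" "set h \<subset> X"
  shows "\<exists>x\<in>X - set h. pos Dominator r (live_edges E first (h @ [x]))"
proof -
  let ?F = "live_edges E first h"
  obtain x where x: "pos Dominator r ((\<lambda>e. e - {x}) ` ?F)"
    using assms(1) by (auto simp: pos_Staller_Suc)
  show ?thesis
  proof (cases "x \<in> X - set h")
    case True
    then show ?thesis using x assms(2) by (auto simp: live_edges_staller_move)
  next
    case False
    obtain z where z: "z \<in> X - set h" using assms(4) by blast
    have "x \<notin> e" if "e \<in> ?F" for e
    proof -
      have "e \<subseteq> X" using that assms(3) by (auto simp: live_edges_def)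
      then show ?thesis using False live_edges_disjoint[OF that] by blast
    qed
    then have "(\<lambda>e. e - {x}) ` ?F = ?F" by simp
    then have "pos Dominator r ?F" using x by simp
    then have "pos Dominator r ((\<lambda>e. e - {z}) ` ?F)"
      by (rule pos_mono) blast
    then show ?thesis using z assms(2) by (auto simp: live_edges_staller_move)
  qed
qed

text \<open>The same repair for Dominator: an illegal reply hits no live edge, and a free vertex
  played instead can only remove edges.\<close>

lemma not_pos_dominator_step:
  assumes "\<not> pos Dominator r (live_edges E first h)" "mover first (length h) = Dominator"
    and "\<Union>E \<subseteq> X" "set h \<subset> X"
  shows "\<exists>y\<in>X - set h. \<not> pos Staller r (live_edges E first (h @ [y]))"
proof -
  let ?F = "live_edges E first h"
  obtain y where y: "\<not> pos Staller r {e \<in> ?F. y \<notin> e}"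
    using assms(1) by (auto simp: pos_simps)
  show ?thesis
  proof (cases "y \<in> X - set h")
    case True
    then show ?thesis using y assms(2) by (auto simp: live_edges_dominator_move)
  next
    case False
    obtain z where z: "z \<in> X - set h" using assms(4) by blast
    have "y \<notin> e" if "e \<in> ?F" for e
    proof -
      have "e \<subseteq> X" using that assms(3) by (auto simp: live_edges_def)
      then show ?thesis using False live_edges_disjoint[OF that] by blast
    qed
    then have "{e \<in> ?F. y \<notin> e} = ?F" by auto
    then have "\<not> pos Staller r {e \<in> ?F. z \<notin> e}"
      using y pos_mono[of Staller r "{e \<in> ?F. z \<notin> e}" ?F] by auto
    then show ?thesis using z assms(2) by (auto simp: live_edges_dominator_move)
  qed
qed

text \<open>Staller always moves to a position that is still winning with her remaining budget; once
  the board is full, such a position contains an empty edge.\<close>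

lemma pos_imp_staller_wins_within:
  assumes fin: "finite (pverts G)" and sub: "\<Union>(closed_nbhd G ` pverts G) \<subseteq> pverts G"
    and pos: "pos first t (closed_nbhd G ` pverts G)"
  shows "staller_wins_within first G t"
proof -
  let ?X = "pverts G" and ?E = "closed_nbhd G ` pverts G"
  let ?F = "live_edges ?E first" and ?c = "\<lambda>h. card (played_by Staller first h)"
  define good where "good h x \<longleftrightarrow> x \<in> ?X - set h \<and> pos Dominator (t - ?c h - 1) (?F (h @ [x]))" for h x
  \<comment> \<open>Legality is demanded on every history, also on those that never arise in the
    play, hence the default of some free vertex.\<close>
  define s where "s h = (if \<exists>x. good h x then SOME x. good h x else SOME x. x \<in> ?X - set h)" for h
  have s_good: "good h (s h)" if "\<exists>x. good h x" for h
    using someI_ex[OF that] that by (simp add: s_def)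
  have legal: "legal_strategy G s"
    unfolding legal_strategy_def
  proof (intro allI impI)
    fix h assume h: "distinct h \<and> set h \<subset> ?X"
    show "s h \<in> ?X - set h"
    proof (cases "\<exists>x. good h x")
      case True
      then show ?thesis using s_good by (auto simp: good_def)
    next
      case False
      have "\<exists>x. x \<in> ?X - set h" using h by blast
      from someI_ex[OF this] False show ?thesis by (simp add: s_def)
    qed
  qed
  have "\<exists>m\<le>card ?X. staller_won G first (play first d s m) \<and> ?c (play first d s m) \<le> t"
    if d: "legal_strategy G d" for d
  proof -
    let ?h = "play first d s"
    note pl = play_legal[OF d legal fin, of _ first]
    have inv: "(\<exists>m'\<le>m. staller_won G first (?h m') \<and> ?c (?h m') \<le> t) \<or>
        ?c (?h m) \<le> t \<and> pos (mover first m) (t - ?c (?h m)) (?F (?h m))" if "m \<le> card ?X" for m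
      using that
    proof (induction m)
      case 0
      then show ?case using pos by (simp add: mover_def)
    next
      case (Suc m)
      show ?case
      proof (cases "\<exists>m'\<le>Suc m. staller_won G first (?h m') \<and> ?c (?h m') \<le> t")
        case True
        then show ?thesis by blast
      next
        case False
        then have IH: "?c (?h m) \<le> t" "pos (mover first m) (t - ?c (?h m)) (?F (?h m))"
          using Suc by (auto simp del: play.simps)
        have h: "distinct (?h m)" "set (?h m) \<subseteq> ?X" using pl[of m] Suc.prems by auto
        have "card (set (?h m)) = m" using h(1) by (simp add: distinct_card)
        then have h': "set (?h m) \<subset> ?X" using h(2) Suc.prems by auto
        show ?thesis
        proof (cases "mover first m")
          case Dominator
          have "d (?h m) \<in> ?X - set (?h m)"
            using d h h' by (auto simp: legal_strategy_def)
          then show ?thesis using IH Dominator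
            by (auto simp: Let_def mover_Suc played_by_snoc live_edges_dominator_move pos_simps)
        next
          case Staller
          \<comment> \<open>With no budget left and Staller to move, a winning position already
            contains an empty edge, that is, she has won before.\<close>
          have "t - ?c (?h m) \<noteq> 0"
          proof
            assume "t - ?c (?h m) = 0"
            then have "{} \<in> ?F (?h m)" using IH(2) Staller by (simp add: pos_simps)
            then have "staller_won G first (?h m)" using staller_won_iff[OF h(1)] by blast
            then show False using False IH(1) by (meson le_SucI order_refl)
          qed
          then have r: "t - ?c (?h m) = Suc (t - ?c (?h m) - 1)" by simp
          have "\<exists>x. good (?h m) x"
            using pos_staller_step[of "t - ?c (?h m) - 1" ?E first "?h m" ?X] IH(2) r Staller sub h'
            by (auto simp: good_def)
          from s_good[OF this] have g: "s (?h m) \<in> ?X - set (?h m)"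
            "pos Dominator (t - ?c (?h m) - 1) (?F (?h m @ [s (?h m)]))"
            by (auto simp: good_def)
          have "s (?h m) \<notin> played_by Staller first (?h m)"
            using g(1) played_by_Un[of first "?h m"] by blast
          then have "?c (?h (Suc m)) = Suc (?c (?h m))"
            using Staller by (simp add: Let_def played_by_snoc)
          moreover have "Suc (?c (?h m)) \<le> t" using r by linarith
          ultimately show ?thesis using g(2) Staller
            by (simp add: Let_def mover_Suc)
        qed
      qed
    qed
    let ?g = "?h (card ?X)"
    have h: "distinct ?g" "set ?g \<subseteq> ?X" using pl[of "card ?X"] by auto
    have "card (set ?g) = card ?X" using h(1) by (simp add: distinct_card)
    then have full: "set ?g = ?X" using h(2) fin by (simp add: card_subset_eq)
    have empty: "e = {}" if "e \<in> ?F ?g" for e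
    proof -
      have "e \<subseteq> ?X" using that sub by (auto simp: live_edges_def)
      then show ?thesis using live_edges_disjoint[OF that] full by blast
    qed
    have won: "staller_won G first ?g" if "pos p r (?F ?g)" for p r
    proof -
      have "win r (?F ?g)"
      proof (cases p)
        case Dominator
        \<comment> \<open>Any reply serves here; \<open>undefined\<close> is an arbitrary
          one.\<close>
        then have "win r {e \<in> ?F ?g. undefined \<notin> e}" using that by (simp add: pos_simps)
        then show ?thesis by (rule win_mono) auto
      next
        case Staller
        then show ?thesis using that by (simp add: pos_simps)
      qed
      then have "{} \<in> ?F ?g" using win_only_empty_edge empty by blast
      then show ?thesis using staller_won_iff[OF h(1)] by blast
    qed
    show ?thesis using inv[OF order_refl] won by blast
  qed
  then show ?thesis using legal unfolding staller_wins_within_def by blast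
qed

text \<open>By contraposition: Dominator can keep a position that is not winning for Staller in that
  state, which defeats every \<open>s\<close> within the budget \<open>t\<close>.\<close>

lemma staller_wins_within_imp_pos:
  assumes fin: "finite (pverts G)" and sub: "\<Union>(closed_nbhd G ` pverts G) \<subseteq> pverts G"
    and wins: "staller_wins_within first G t"
  shows "pos first t (closed_nbhd G ` pverts G)"
proof (rule ccontr)
  let ?X = "pverts G" and ?E = "closed_nbhd G ` pverts G"
  let ?F = "live_edges ?E first" and ?c = "\<lambda>h. card (played_by Staller first h)"
  assume npos: "\<not> pos first t ?E"
  obtain s where legal: "legal_strategy G s" and s: "\<And>d. legal_strategy G d \<Longrightarrow>
      \<exists>m\<le>card ?X. staller_won G first (play first d s m) \<and> ?c (play first d s m) \<le> t"
    using wins unfolding staller_wins_within_def by blast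
  define good where "good h y \<longleftrightarrow> y \<in> ?X - set h \<and> \<not> pos Staller (t - ?c h) (?F (h @ [y]))" for h y
  define d where "d h = (if \<exists>y. good h y then SOME y. good h y else SOME y. y \<in> ?X - set h)" for h
  have d_good: "good h (d h)" if "\<exists>y. good h y" for h
    using someI_ex[OF that] that by (simp add: d_def)
  have d: "legal_strategy G d"
    unfolding legal_strategy_def
  proof (intro allI impI)
    fix h assume h: "distinct h \<and> set h \<subset> ?X"
    show "d h \<in> ?X - set h"
    proof (cases "\<exists>y. good h y")
      case True
      then show ?thesis using d_good by (auto simp: good_def)
    next
      case False
      have "\<exists>y. y \<in> ?X - set h" using h by blast
      from someI_ex[OF this] False show ?thesis by (simp add: d_def)
    qed
  qed
  let ?h = "play first d s"
  note pl = play_legal[OF d legal fin, of _ first]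
  have inv: "\<not> pos (mover first m) (t - ?c (?h m)) (?F (?h m))"
    if "m \<le> card ?X" "?c (?h m) \<le> t" for m
    using that
  proof (induction m)
    case 0
    then show ?case using npos by (simp add: mover_def)
  next
    case (Suc m)
    have h: "distinct (?h m)" "set (?h m) \<subseteq> ?X" using pl[of m] Suc.prems by auto
    have "card (set (?h m)) = m" using h(1) by (simp add: distinct_card)
    then have h': "set (?h m) \<subset> ?X" using h(2) Suc.prems by auto
    show ?case
    proof (cases "mover first m")
      case Dominator
      then have c: "?c (?h (Suc m)) = ?c (?h m)"
        by (simp add: Let_def played_by_snoc)
      then have "\<not> pos Dominator (t - ?c (?h m)) (?F (?h m))" using Suc Dominator by simp
      from not_pos_dominator_step[OF this _ sub h'] Dominator
      have "\<exists>y. good (?h m) y" by (auto simp: good_def)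
      from d_good[OF this] show ?thesis using c Dominator
        by (simp add: good_def Let_def mover_Suc)
    next
      case Staller
      have "s (?h m) \<in> ?X - set (?h m)"
        using legal h h' by (auto simp: legal_strategy_def)
      then have "s (?h m) \<notin> played_by Staller first (?h m)"
        using played_by_Un[of first "?h m"] by blast
      then have c: "?c (?h (Suc m)) = Suc (?c (?h m))"
        using Staller by (simp add: Let_def played_by_snoc)
      then have r: "t - ?c (?h m) = Suc (t - ?c (?h (Suc m)))" using Suc.prems(2) by simp
      have "\<not> pos Staller (t - ?c (?h m)) (?F (?h m))" using Suc c Staller by simp
      then have "\<not> pos Dominator (t - ?c (?h (Suc m))) ((\<lambda>e. e - {s (?h m)}) ` ?F (?h m))"
        unfolding r pos_Staller_Suc by blast
      then show ?thesis using Staller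
        by (simp add: Let_def mover_Suc live_edges_staller_move)
    qed
  qed
  obtain m where m: "m \<le> card ?X" "staller_won G first (?h m)" "?c (?h m) \<le> t"
    using s[OF d] by blast
  \<comment> \<open>A won history has an empty live edge, so its position is winning for Staller
    with any budget, against the invariant.\<close>
  have "{} \<in> ?F (?h m)" using m pl[of m] staller_won_iff by blast
  then have "pos (mover first m) (t - ?c (?h m)) (?F (?h m))"
    by (cases "mover first m") (auto simp: pos_simps win_empty_edge)
  then show False using inv m by blast
qed

subsection \<open>Closed neighbourhoods, matchings and paths\<close>

locale reflexive_graph =
  fixes N :: "'a \<Rightarrow> 'a set"
  assumes self: "v \<in> N v"
    and sym: "u \<in> N v \<Longrightarrow> v \<in> N u"
begin

text \<open>The edges of the game on the subgraph induced by \<open>W\<close>.\<close>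

definition nbhds :: "'a set \<Rightarrow> 'a set set" where
  "nbhds W = (\<lambda>v. N v \<inter> W) ` W"

text \<open>The subgraph induced by \<open>M\<close> has a perfect matching; it is built pair by
  pair so that \<open>win_pair\<close> can be iterated.\<close>

inductive matched :: "'a set \<Rightarrow> bool" where
  empty: "matched {}"
| pair: "matched M \<Longrightarrow> p \<notin> M \<Longrightarrow> q \<notin> M \<Longrightarrow> p \<noteq> q \<Longrightarrow> q \<in> N p \<Longrightarrow> matched (insert p (insert q M))"

lemma matched_Un: "matched A \<Longrightarrow> matched B \<Longrightarrow> A \<inter> B = {} \<Longrightarrow> matched (A \<union> B)"
proof (induction rule: matched.induct)
  case (pair M p q)
  then have "matched (insert p (insert q (M \<union> B)))"
    by (intro matched.pair) auto
  then show ?case by (simp add: Un_insert_left)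
qed simp

lemma matched_path:
  assumes "inj_on w {a..<b}" "\<And>i. a \<le> i \<Longrightarrow> Suc i < b \<Longrightarrow> w (Suc i) \<in> N (w i)" "even (b - a)"
  shows "matched (w ` {a..<b})"
  using assms
proof (induction b rule: less_induct)
  case (less b)
  show ?case
  proof (cases "b - a = 0")
    case True
    then show ?thesis by (simp add: matched.empty)
  next
    case False
    then have "a + 2 \<le> b" using less.prems(3) by presburger
    then obtain c where c: "b = Suc (Suc c)" "a \<le> c" by (auto simp: le_iff_add)
    have "matched (w ` {a..<c})"
      using less.prems c by (intro less.IH) (auto simp: Suc_diff_le intro: inj_on_subset)
    moreover have "w ` {a..<b} = insert (w c) (insert (w (Suc c)) (w ` {a..<c}))"
      using c by (auto simp: atLeastLessThanSuc)
    moreover have "w c \<notin> w ` {a..<c}" "w (Suc c) \<notin> w ` {a..<c}" "w c \<noteq> w (Suc c)"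
      using less.prems(1) c by (auto dest!: inj_onD)
    ultimately show ?thesis using less.prems(2)[of c] c by (simp add: matched.pair)
  qed
qed

text \<open>The pairing strategy. The neighbourhoods of \<open>p\<close> and \<open>q\<close> both
  contain \<open>{p, q}\<close>, so Staller loses nothing if this pair replaces them, and
  \<open>win_pair\<close> discards the pair.\<close>

lemma win_matched:
  assumes "matched M" "win t (nbhds M \<union> F)" "M \<inter> \<Union>F = {}"
  shows "win t F"
  using assms
proof (induction rule: matched.induct)
  case empty
  then show ?case by (simp add: nbhds_def)
next
  case (pair M p q)
  have "win t (insert {p, q} (nbhds M \<union> F))"
  proof (rule win_mono[OF pair.prems(1)])
    fix e assume "e \<in> nbhds (insert p (insert q M)) \<union> F"
    then consider "e \<in> F" | "e = N p \<inter> insert p (insert q M)"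
      | "e = N q \<inter> insert p (insert q M)" | v where "v \<in> M" "e = N v \<inter> insert p (insert q M)"
      by (auto simp: nbhds_def)
    then show "\<exists>e'\<in>insert {p, q} (nbhds M \<union> F). e' \<subseteq> e"
    proof cases
      case 4
      then have "N v \<inter> M \<in> nbhds M" "N v \<inter> M \<subseteq> e" by (auto simp: nbhds_def)
      then show ?thesis by blast
    qed (use self sym pair.hyps(5) in auto)
  qed
  then have "win t (nbhds M \<union> F)"
    using pair.hyps(2-4) pair.prems(2) by (rule_tac win_pair) (auto simp: nbhds_def)
  then show ?case using pair by blast
qed

lemma not_win_matched: "matched M \<Longrightarrow> \<not> win t (nbhds M)"
  using win_matched[of M t "{}"] by auto

text \<open>
  Dominator answers \<open>x\<close> by a neighbour \<open>y\<close> of \<open>x\<close>; besides what \<open>y\<close> dominates and a matched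
  set, on which he answers along the matching, only \<open>R\<close> remains to be fought for.
\<close>

lemma win_reply:
  assumes "win t (residual x y (nbhds W))" "y \<in> N x" "y \<noteq> x" "y \<in> W"
    and "matched M" "W \<subseteq> M \<union> R \<union> N y" "M \<inter> R = {}" "M \<subseteq> W" "R \<subseteq> W" "x \<notin> M" "x \<notin> R"
  shows "win t (nbhds R)"
proof -
  have "win t (nbhds M \<union> nbhds R)"
  proof (rule win_mono[OF assms(1)])
    fix e assume "e \<in> residual x y (nbhds W)"
    then obtain v where v: "v \<in> W" "e = N v \<inter> W - {x}" "y \<notin> e"
      by (auto simp: residual_def nbhds_def)
    then have "y \<notin> N v" using assms by auto
    then have "v \<in> M \<or> v \<in> R" using sym v assms(6) by blast
    then have "\<exists>Q. (Q = M \<or> Q = R) \<and> v \<in> Q" by blast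
    then obtain Q where Q: "Q = M \<or> Q = R" "v \<in> Q" by blast
    \<comment> \<open>Cutting the edge of \<open>v\<close> down to its own part \<open>Q\<close>
      favours Staller and makes the two parts vertex-disjoint, as \<open>win_matched\<close>
      requires.\<close>
    then have "N v \<inter> Q \<subseteq> e" using v assms by blast
    moreover have "N v \<inter> Q \<in> nbhds M \<union> nbhds R" using Q by (auto simp: nbhds_def)
    ultimately show "\<exists>e'\<in>nbhds M \<union> nbhds R. e' \<subseteq> e" by blast
  qed
  then show ?thesis using assms(5,7) by (rule_tac win_matched) (auto simp: nbhds_def)
qed

lemma win_reply_matched:
  assumes "win t (residual x y (nbhds W))" "y \<in> N x" "y \<noteq> x" "y \<in> W"
    and "matched M" "W \<subseteq> M \<union> N y" "M \<subseteq> W" "x \<notin> M"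
  shows False
proof -
  have "win t (nbhds {})" using assms by (intro win_reply[OF assms(1-5)]) auto
  then show False by (simp add: nbhds_def)
qed

lemma win_pass:
  assumes "win t (residual x x (nbhds W))" "x \<notin> W"
  shows "win t (nbhds W)"
proof -
  have "x \<notin> \<Union>(nbhds W)" using assms(2) by (auto simp: nbhds_def)
  then show ?thesis using assms(1) by (simp add: residual_pass)
qed

section \<open>How many moves Staller needs on a path\<close>

lemma not_win_0: "\<not> win 0 (nbhds W)"
  using self by (auto simp: nbhds_def)

text \<open>The open interval has \<open>b - a - 1\<close> vertices, an odd number. A move
  \<open>w m\<close> at even distance from \<open>a\<close> leaves two odd paths; Dominator can
  neutralise either by replying on that side, so both \<open>m - a\<close> and \<open>b - m\<close>
  are at most \<open>2 ^ t\<close>. After a move at odd distance a reply leaves only paired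
  vertices, unless the path is a single vertex.\<close>

lemma win_path_imp_le:
  assumes "inj_on w {a<..<b}" "\<And>i. a < i \<Longrightarrow> Suc i < b \<Longrightarrow> w (Suc i) \<in> N (w i)"
    and "a < b" "even (b - a)" "win t (nbhds (w ` {a<..<b}))"
  shows "b - a \<le> 2 ^ t"
  using assms
proof (induction t arbitrary: a b)
  case 0
  then show ?case using not_win_0 by simp
next
  case (Suc t)
  let ?W = "w ` {a<..<b}"
  note inj = inj_onD[OF Suc.prems(1)] and adj = Suc.prems(2)
  have w_eq: "w i = w j \<longleftrightarrow> i = j" if "a < i" "i < b" "a < j" "j < b" for i j
    using inj_on_eq_iff[OF Suc.prems(1)] that by simp
  obtain x where x: "\<And>y. win t (residual x y (nbhds ?W))" using Suc.prems(5) by auto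
  have matched: "matched (w ` {c..<d})" if "a < c" "d \<le> b" "even (d - c)" for c d
    using that adj by (intro matched_path) (auto intro: inj_on_subset[OF Suc.prems(1)])
  show ?case
  proof (cases "x \<in> ?W")
    case False
    then have "b - a \<le> 2 ^ t" using Suc.IH[OF Suc.prems(1-4)] win_pass[OF x] by blast
    then show ?thesis by simp
  next
    case True
    then obtain m where m: "x = w m" "a < m" "m < b" by auto
    show ?thesis
    proof (cases "even (m - a)")
      case True
      have m2: "Suc a < m" "Suc m < b"
        using True m Suc.prems(4) by presburger+
      \<comment> \<open>The reply on the left dominates \<open>w (m - 1)\<close> and
        \<open>w m\<close>; the even number of vertices before them is paired, and the right part
        remains.\<close>
      have "win t (nbhds (w ` {m<..<b}))"
      proof (rule win_reply[OF x[of "w (m - 1)"], where M = "w ` {Suc a..<m - 1}"])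
        show "w (m - 1) \<in> N x" using adj[of "m - 1"] m m2 sym by auto
        show "w (m - 1) \<noteq> x" using m m2 by (simp add: w_eq)
        show "w (m - 1) \<in> ?W" using m m2 by (intro imageI) auto
        show "matched (w ` {Suc a..<m - 1})" using True m2 m by (intro matched) auto
        show "?W \<subseteq> w ` {Suc a..<m - 1} \<union> w ` {m<..<b} \<union> N (w (m - 1))"
        proof
          fix v assume "v \<in> ?W"
          then obtain i where i: "v = w i" "a < i" "i < b" by auto
          consider "i < m - 1" | "i = m - 1" | "i = m" | "i > m" by linarith
          then show "v \<in> w ` {Suc a..<m - 1} \<union> w ` {m<..<b} \<union> N (w (m - 1))"
            using i adj[of "m - 1"] m m2 self by cases auto
        qed
        show "w ` {Suc a..<m - 1} \<inter> w ` {m<..<b} = {}" using m m2 by (auto dest!: inj)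
      qed (use m m2 in \<open>auto dest!: inj\<close>)
      then have "b - m \<le> 2 ^ t"
        using m Suc.prems(4) True adj
        by (intro Suc.IH) (auto intro: inj_on_subset[OF Suc.prems(1)])
      moreover have "win t (nbhds (w ` {a<..<m}))"
      proof (rule win_reply[OF x[of "w (Suc m)"], where M = "w ` {Suc (Suc m)..<b}"])
        show "w (Suc m) \<in> N x" using adj[of m] m m2 by auto
        show "w (Suc m) \<noteq> x" using m m2 by (simp add: w_eq)
        show "matched (w ` {Suc (Suc m)..<b})"
        proof (rule matched)
          show "even (b - Suc (Suc m))" using True m2 m(2,3) Suc.prems(4) by presburger
        qed (use m in auto)
        show "?W \<subseteq> w ` {Suc (Suc m)..<b} \<union> w ` {a<..<m} \<union> N (w (Suc m))"
        proof
          fix v assume "v \<in> ?W"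
          then obtain i where i: "v = w i" "a < i" "i < b" by auto
          consider "i < m" | "i = m" | "i = Suc m" | "i > Suc m" by linarith
          then show "v \<in> w ` {Suc (Suc m)..<b} \<union> w ` {a<..<m} \<union> N (w (Suc m))"
            using i adj[of m] m m2 self sym by cases auto
        qed
        show "w ` {Suc (Suc m)..<b} \<inter> w ` {a<..<m} = {}" using m m2 by (auto dest!: inj)
      qed (use m m2 in \<open>auto dest!: inj\<close>)
      then have "m - a \<le> 2 ^ t"
        using m Suc.prems(4) True adj
        by (intro Suc.IH) (auto intro: inj_on_subset[OF Suc.prems(1)])
      ultimately show ?thesis by simp
    next
      case odd: False
      show ?thesis
      proof (cases "Suc m < b")
        case True
        \<comment> \<open>The reply \<open>w (Suc m)\<close> dominates three vertices, from
          \<open>w m\<close> to \<open>w (Suc (Suc m))\<close>, and leaves an even number on each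
          side.\<close>
        have False
        proof (rule win_reply_matched[OF x[of "w (Suc m)"],
              where M = "w ` {Suc a..<m} \<union> w ` {Suc (Suc (Suc m))..<b}"])
          show "w (Suc m) \<in> N x" using adj[of m] m True by auto
          show "w (Suc m) \<noteq> x" using m True by (simp add: w_eq)
          show "matched (w ` {Suc a..<m} \<union> w ` {Suc (Suc (Suc m))..<b})"
          proof (rule matched_Un)
            show "matched (w ` {Suc a..<m})" using odd m by (intro matched) auto
            show "matched (w ` {Suc (Suc (Suc m))..<b})"
            proof (rule matched)
              show "even (b - Suc (Suc (Suc m)))" using odd m(2,3) Suc.prems(4) by presburger
            qed (use m in auto)
          qed (use m in \<open>auto dest!: inj\<close>)
          show "?W \<subseteq> w ` {Suc a..<m} \<union> w ` {Suc (Suc (Suc m))..<b} \<union> N (w (Suc m))"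
          proof
            fix v assume "v \<in> ?W"
            then obtain i where i: "v = w i" "a < i" "i < b" by auto
            consider "i < m" | "i = m" | "i = Suc m" | "i = Suc (Suc m)" | "i > Suc (Suc m)" by linarith
            then show "v \<in> w ` {Suc a..<m} \<union> w ` {Suc (Suc (Suc m))..<b} \<union> N (w (Suc m))"
              using i adj[of m] adj[of "Suc m"] m True self sym by cases auto
          qed
        qed (use m True in \<open>auto dest!: inj\<close>)
        then show ?thesis ..
      next
        case False
        then have b: "b = Suc m" using m by simp
        show ?thesis
        proof (cases "Suc a = m")
          \<comment> \<open>On a single vertex Staller does win, and the bound reads
            \<open>2 \<le> 2 ^ Suc t\<close>.\<close>
          case True
          then have "b - a = 2" using b by simp
          then show ?thesis by simp
        next
          case False
          then have m2: "Suc (Suc a) < m" using odd m by presburger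
          \<comment> \<open>Here \<open>w m\<close> is the last vertex; the reply
            \<open>w (m - 1)\<close> dominates it and \<open>w (m - 2)\<close>.\<close>
          have False
          proof (rule win_reply_matched[OF x[of "w (m - 1)"], where M = "w ` {Suc a..<m - 2}"])
            show "w (m - 1) \<in> N x" using adj[of "m - 1"] m m2 sym by auto
            show "w (m - 1) \<noteq> x" using m m2 by (simp add: w_eq)
            show "w (m - 1) \<in> ?W" using m m2 by (intro imageI) auto
            show "matched (w ` {Suc a..<m - 2})" using odd m2 m by (intro matched) auto
            show "?W \<subseteq> w ` {Suc a..<m - 2} \<union> N (w (m - 1))"
            proof
              fix v assume "v \<in> ?W"
              then obtain i where i: "v = w i" "a < i" "i < b" by auto
              have e: "Suc (m - 2) = m - 1" "Suc (m - 1) = m" using m2 by auto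
              consider "i < m - 2" | "i = m - 2" | "i = m - 1" | "i = m" using i b by linarith
              then show "v \<in> w ` {Suc a..<m - 2} \<union> N (w (m - 1))"
                using i adj[of "m - 2"] adj[of "m - 1"] m m2 self sym unfolding e by cases auto
            qed
          qed (use m m2 in \<open>auto dest!: inj\<close>)
          then show ?thesis ..
        qed
      qed
    qed
  qed
qed

text \<open>Dominator opens with \<open>y\<close>, which settles all of \<open>N y\<close>, and
  pairs on \<open>M\<close> from then on.\<close>

lemma not_pos_Dominator:
  assumes "y \<in> W" "W \<subseteq> M \<union> N y" "M \<subseteq> W" "matched M"
  shows "\<not> pos Dominator t (nbhds W)"
proof
  assume "pos Dominator t (nbhds W)"
  then have "win t {e \<in> nbhds W. y \<notin> e}" by (simp add: pos_simps)
  then have "win t (nbhds M)"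
  proof (rule win_mono)
    fix e assume "e \<in> {e \<in> nbhds W. y \<notin> e}"
    then obtain v where v: "v \<in> W" "e = N v \<inter> W" "y \<notin> e" by (auto simp: nbhds_def)
    then have "v \<notin> N y" using sym assms(1) by blast
    then have "v \<in> M" using v assms(2) by blast
    then have "N v \<inter> M \<in> nbhds M" "N v \<inter> M \<subseteq> e" using v assms(3) by (auto simp: nbhds_def)
    then show "\<exists>e'\<in>nbhds M. e' \<subseteq> e" by blast
  qed
  then show False using not_win_matched[OF assms(4)] by blast
qed

end

text \<open>Staller cuts at even distance from \<open>a\<close>. Dominator's reply misses one of the
  two sides, where she continues, down to a single vertex at odd distance. Hence edges are assumed
  around odd positions only, which lets the path run through the branch vertex of a tadpole at an
  even position.\<close>

lemma win_path:
  fixes w :: "nat \<Rightarrow> 'a"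
  assumes "inj_on w {a<..<b}" "a < b" "even (b - a)" "b - a \<le> 2 ^ t"
    and "\<And>i. a < i \<Longrightarrow> i < b \<Longrightarrow> odd (i - a) \<Longrightarrow> \<exists>e\<in>F. e \<subseteq> w ` ({i - 1..i + 1} \<inter> {a<..<b})"
  shows "win t F"
  using assms
proof (induction t arbitrary: a b F)
  case 0
  then show ?case by (cases "b - a") auto
next
  case (Suc t)
  note inj = inj_onD[OF Suc.prems(1)]
  show ?case
  proof (cases "b - a \<le> 2")
    case True
    then have b: "b = Suc (Suc a)" using Suc.prems(2,3) by presburger
    then have "{Suc a - 1..Suc a + 1} \<inter> {a<..<b} = {Suc a}" by auto
    then obtain e where e: "e \<in> F" "e \<subseteq> {w (Suc a)}"
      using Suc.prems(5)[of "Suc a"] b by auto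
    have "e - {w (Suc a)} \<in> residual (w (Suc a)) y F" for y
      using e by (intro residualI) auto
    moreover have "e - {w (Suc a)} = {}" using e by auto
    ultimately have "win t (residual (w (Suc a)) y F)" for y using win_empty_edge by metis
    then show ?thesis by auto
  next
    case False
    then have "t \<noteq> 0" using Suc.prems(4) by (cases t) auto
    \<comment> \<open>The left side takes the full budget \<open>2 ^ t\<close>, but at most
      \<open>b - a - 2\<close>, so that a vertex remains on the right.\<close>
    define p where "p = min (2 ^ t) (b - a - 2)"
    have p: "even p" "0 < p" "p < b - a" "p \<le> 2 ^ t" "b - a - p \<le> 2 ^ t"
      using False Suc.prems(3,4) \<open>t \<noteq> 0\<close> self_le_power[of 2 t] by (auto simp: p_def min_def)
    define m where "m = a + p"
    have m: "a < m" "m < b" "even (m - a)" "m - a \<le> 2 ^ t" "b - m \<le> 2 ^ t" "even (b - m)"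
      using p Suc.prems(3) by (auto simp: m_def)
    \<comment> \<open>Deleting \<open>w m\<close> confines the edges of each side to that side, and
      a reply elsewhere does not touch them.\<close>
    have edge: "\<exists>e\<in>residual (w m) y F. e \<subseteq> w ` ({i - 1..i + 1} \<inter> {c<..<d})"
      if y: "y \<notin> w ` {c<..<d}" and cd: "(c, d) = (a, m) \<or> (c, d) = (m, b)"
        and i: "c < i" "i < d" "odd (i - c)" for i c d y
    proof -
      have "odd (i - a)" using cd i m by auto
      then obtain e where e: "e \<in> F" "e \<subseteq> w ` ({i - 1..i + 1} \<inter> {a<..<b})"
        using Suc.prems(5)[of i] i cd m by auto
      have "e - {w m} \<subseteq> w ` ({i - 1..i + 1} \<inter> {c<..<d})"
      proof
        fix v assume v: "v \<in> e - {w m}"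
        then have "v \<in> w ` ({i - 1..i + 1} \<inter> {a<..<b})" using e(2) by blast
        then obtain j where j: "v = w j" "j \<in> {i - 1..i + 1} \<inter> {a<..<b}" by blast
        moreover have "j \<noteq> m" using v j(1) by blast
        ultimately have "c < j \<and> j < d" using cd i by auto
        then show "v \<in> w ` ({i - 1..i + 1} \<inter> {c<..<d})" using j by auto
      qed
      moreover from this have "e - {w m} \<in> residual (w m) y F"
        using e(1) y by (intro residualI) auto
      ultimately show ?thesis by blast
    qed
    have "win t (residual (w m) y F)" for y
    proof (cases "y \<in> w ` {a<..<m}")
      case True
      then have y: "y \<notin> w ` {m<..<b}" using m by (auto dest!: inj)
      show ?thesis
      proof (rule Suc.IH[of m b])
        show "inj_on w {m<..<b}" using m by (auto intro: inj_on_subset[OF Suc.prems(1)])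
        show "\<exists>e\<in>residual (w m) y F. e \<subseteq> w ` ({i - 1..i + 1} \<inter> {m<..<b})"
          if "m < i" "i < b" "odd (i - m)" for i
          using y _ that by (rule edge) simp
      qed (use m in auto)
    next
      case y: False
      show ?thesis
      proof (rule Suc.IH[of a m])
        show "inj_on w {a<..<m}" using m by (auto intro: inj_on_subset[OF Suc.prems(1)])
        show "\<exists>e\<in>residual (w m) y F. e \<subseteq> w ` ({i - 1..i + 1} \<inter> {a<..<m})"
          if "a < i" "i < m" "odd (i - a)" for i
          using y _ that by (rule edge) simp
      qed (use m in auto)
    qed
    then show ?thesis by auto
  qed
qed

subsection \<open>Tadpole graphs\<close>

locale tadpole_game =
  fixes n k :: nat
  assumes n3: "3 \<le> n" and k1: "1 \<le> k"
begin

abbreviation N :: "tadpole_vertex \<Rightarrow> tadpole_vertex set" where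
  "N \<equiv> closed_nbhd (tadpole n k)"

sublocale reflexive_graph N
  by unfold_locales (auto simp: closed_nbhd_def tadpole_def)

section \<open>Adjacency in the tadpole graph\<close>

lemma N_V_Suc: "Suc i < n \<Longrightarrow> V (Suc i) \<in> N (V i)"
  by (auto simp: closed_nbhd_def tadpole_def tadpole_edges_def)

lemma N_V_wrap: "V 0 \<in> N (V (n - Suc 0))"
  using n3 by (auto simp: closed_nbhd_def tadpole_def tadpole_edges_def intro!: exI[of _ "n - 1"])

lemma N_U_Suc: "0 < j \<Longrightarrow> j < k \<Longrightarrow> U (Suc j) \<in> N (U j)"
  by (auto simp: closed_nbhd_def tadpole_def tadpole_edges_def)

lemma N_U_last: "V 0 \<in> N (U k)"
  by (auto simp: closed_nbhd_def tadpole_def tadpole_edges_def)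

lemma N_V_D:
  assumes "x \<in> N (V i)" "0 < i" "i < n"
  shows "x = V (i - 1) \<or> x = V i \<or> Suc i < n \<and> x = V (Suc i) \<or> Suc i = n \<and> x = V 0"
proof -
  have "j = i - 1" if "j < n" "i = Suc j mod n" for j
    using that assms(2) by (cases "Suc j = n") auto
  moreover have "Suc i mod n = (if Suc i = n then 0 else Suc i)" using assms(3) by auto
  ultimately show ?thesis using assms
    by (auto simp: closed_nbhd_def tadpole_def tadpole_edges_def split: if_splits)
qed

lemma N_U_D:
  assumes "x \<in> N (U j)"
  shows "x = U (j - 1) \<or> x = U j \<or> j = k \<and> x = V 0 \<or> j \<noteq> k \<and> x = U (Suc j)"
  using assms by (auto simp: closed_nbhd_def tadpole_def tadpole_edges_def)

text \<open>The vertices of the tadpole whose tail is cut down to length \<open>k - a\<close>: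
  \<open>U k\<close> is attached to the cycle, so shortening removes the small indices.\<close>

definition W :: "nat \<Rightarrow> tadpole_vertex set" where
  "W a = V ` {0..<n} \<union> U ` {a<..k}"

lemma W_iff [simp]: "V i \<in> W a \<longleftrightarrow> i < n" "U j \<in> W a \<longleftrightarrow> a < j \<and> j \<le> k"
  by (auto simp: W_def)

lemma W_cases:
  assumes "v \<in> W a"
  obtains i where "v = V i" "i < n" | j where "v = U j" "a < j" "j \<le> k"
  using assms by (auto simp: W_def)

lemma closed_nbhd_tadpole: "N ` pverts (tadpole n k) = nbhds (W 0)"
proof -
  have V: "pverts (tadpole n k) = W 0" by (auto simp: tadpole_def W_def)
  have "N v \<inter> W 0 = N v" if "v \<in> W 0" for v
    using that n3 k1
    by (auto simp: W_def closed_nbhd_def tadpole_def tadpole_edges_def)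
  then show ?thesis unfolding V nbhds_def by simp
qed

section \<open>Paths through the tail and around the cycle in both directions\<close>

definition fwd :: "nat \<Rightarrow> tadpole_vertex" where
  "fwd j = (if j \<le> k then U j else V (j - Suc k))"

text \<open>Both numberings go up the tail, reach \<open>V 0\<close> at index \<open>Suc k\<close>
  and then follow the cycle, \<open>fwd\<close> with increasing and \<open>bwd\<close> with
  decreasing indices; \<open>mod n\<close> is there to give \<open>V 0\<close> at index
  \<open>Suc k\<close>.\<close>

definition bwd :: "nat \<Rightarrow> tadpole_vertex" where
  "bwd j = (if j \<le> k then U j else V ((n - (j - Suc k)) mod n))"

lemma inj_fwd: "inj_on fwd A"
  by (auto simp: inj_on_def fwd_def)

lemma bwd_Suc: "0 < l \<Longrightarrow> l \<le> n \<Longrightarrow> bwd (Suc k + l) = V (n - l)"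
  by (auto simp: bwd_def)

lemma bwd_0: "bwd (Suc k) = V 0"
  by (simp add: bwd_def)

lemma inj_bwd: "inj_on bwd {..<Suc k + n}"
proof (rule inj_onI)
  fix x y assume xy: "x \<in> {..<Suc k + n}" "y \<in> {..<Suc k + n}" "bwd x = bwd y"
  have m: "(n - l) mod n = (if l = 0 then 0 else n - l)" if "l < n" for l using that by auto
  have "x - Suc k < n" "y - Suc k < n" using xy n3 by auto
  then show "x = y" using xy m[of "x - Suc k"] m[of "y - Suc k"]
    by (auto simp: bwd_def split: if_splits)
qed

lemma fwd_adj:
  assumes "0 < j" "Suc j < Suc k + n"
  shows "fwd (Suc j) \<in> N (fwd j)"
proof (cases j k rule: linorder_cases)
  case greater
  then have "Suc (j - Suc k) = j - k" by simp
  then show ?thesis using N_V_Suc[of "j - Suc k"] greater assms by (simp add: fwd_def)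
qed (use assms N_U_Suc[of j] N_U_last in \<open>auto simp: fwd_def\<close>)

lemma bwd_adj:
  assumes "0 < j" "Suc j < Suc k + n"
  shows "bwd (Suc j) \<in> N (bwd j)"
proof (cases "j \<le> Suc k")
  case True
  have "bwd (Suc (Suc k)) = V (n - Suc 0)" using bwd_Suc[of 1] n3 by simp
  then have "bwd (Suc (Suc k)) \<in> N (bwd (Suc k))" using sym[OF N_V_wrap] bwd_0 by simp
  moreover have "bwd (Suc j) \<in> N (bwd j)" if "j < k" using that N_U_Suc assms by (simp add: bwd_def)
  moreover have "bwd (Suc k) \<in> N (bwd k)" using N_U_last by (simp add: bwd_def)
  ultimately show ?thesis using True by (metis le_Suc_eq le_neq_implies_less)
next
  case False
  define l where "l = j - Suc k"
  have l: "j = Suc k + l" "0 < l" "Suc l < n" using False assms by (auto simp: l_def)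
  have "bwd j = V (n - l)" "bwd (Suc j) = V (n - Suc l)"
    using l bwd_Suc[of l] bwd_Suc[of "Suc l"] by auto
  moreover have "V (Suc (n - Suc l)) \<in> N (V (n - Suc l))" using l by (intro N_V_Suc) auto
  moreover have "Suc (n - Suc l) = n - l" using l by auto
  ultimately show ?thesis using sym by simp
qed

lemma fwd_image: "fwd ` {a<..<Suc k + i} = U ` {a<..k} \<union> V ` {0..<i}" if "a \<le> k"
proof
  show "fwd ` {a<..<Suc k + i} \<subseteq> U ` {a<..k} \<union> V ` {0..<i}"
    by (auto simp: fwd_def image_iff)
  have "U j = fwd j" if "j \<le> k" for j using that by (simp add: fwd_def)
  moreover have "V j = fwd (Suc k + j)" for j by (simp add: fwd_def)
  ultimately show "U ` {a<..k} \<union> V ` {0..<i} \<subseteq> fwd ` {a<..<Suc k + i}"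
    using that by (auto intro!: imageI simp del: add_Suc)
qed

lemma bwd_image: "bwd ` {a<..<Suc k + (n - i)} = U ` {a<..k} \<union> {V 0} \<union> V ` {i<..<n}"
  if "a \<le> k" "0 < i" "i < n"
proof
  show "bwd ` {a<..<Suc k + (n - i)} \<subseteq> U ` {a<..k} \<union> {V 0} \<union> V ` {i<..<n}"
  proof
    fix v assume "v \<in> bwd ` {a<..<Suc k + (n - i)}"
    then obtain j where j: "v = bwd j" "a < j" "j < Suc k + (n - i)" by auto
    consider "j \<le> k" | "j = Suc k" | "j > Suc k" by linarith
    then show "v \<in> U ` {a<..k} \<union> {V 0} \<union> V ` {i<..<n}"
    proof cases
      case 3
      then have "v = V (n - (j - Suc k))" "n - (j - Suc k) \<in> {i<..<n}"
        using bwd_Suc[of "j - Suc k"] j that by auto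
      then show ?thesis by blast
    qed (use j bwd_0 in \<open>auto simp: bwd_def\<close>)
  qed
  have "U j \<in> bwd ` {a<..<Suc k + (n - i)}" if "a < j" "j \<le> k" for j
    using that by (intro image_eqI[of _ _ j]) (auto simp: bwd_def)
  moreover have "V j \<in> bwd ` {a<..<Suc k + (n - i)}" if "i < j" "j < n" for j
    using that bwd_Suc[of "n - j"] \<open>a \<le> k\<close> by (intro image_eqI[of _ _ "Suc k + (n - j)"]) auto
  moreover have "V 0 \<in> bwd ` {a<..<Suc k + (n - i)}"
    using that bwd_0 by (intro image_eqI[of _ _ "Suc k"]) auto
  ultimately show "U ` {a<..k} \<union> {V 0} \<union> V ` {i<..<n} \<subseteq> bwd ` {a<..<Suc k + (n - i)}" by auto
qed

lemma matched_V: "b \<le> n \<Longrightarrow> even (b - a) \<Longrightarrow> matched (V ` {a..<b})"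
  by (rule matched_path) (auto intro: N_V_Suc inj_onI)

lemma matched_U: "0 < a \<Longrightarrow> b \<le> Suc k \<Longrightarrow> even (b - a) \<Longrightarrow> matched (U ` {a..<b})"
  by (rule matched_path) (auto intro: N_U_Suc inj_onI)

lemma matched_U_V0: "a \<le> k \<Longrightarrow> odd (k - a) \<Longrightarrow> matched (insert (V 0) (U ` {a<..k}))"
proof -
  assume a: "a \<le> k" "odd (k - a)"
  have "fwd ` {Suc a..<Suc k + 1} = insert (V 0) (U ` {a<..k})"
    using fwd_image[OF a(1), of 1] by (simp add: atLeastSucLessThan_greaterThanLessThan)
  moreover have "matched (fwd ` {Suc a..<Suc k + 1})"
    using a n3 by (intro matched_path inj_fwd fwd_adj) auto
  ultimately show ?thesis by simp
qed

section \<open>Staller's strategy on the tadpole\<close>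

text \<open>
  Cutting the tail at distance \<open>2 ^ (t - 1)\<close> from its end halves the budget. Once the tail is
  short, Staller opens the cycle: at \<open>V 0\<close> if \<open>n \<le> 2 ^ (t - 1)\<close>, otherwise opposite to it at
  \<open>V i\<close>. In the latter case Dominator has to reply on one of the two arcs, because otherwise
  \<open>V (i - 1)\<close> is a double threat, and Staller keeps the path formed by the other arc, \<open>V 0\<close>
  and the tail.
\<close>

lemma win_tadpole:
  assumes "even n" "a < k" "odd (k - a)" "n \<le> 2 * 2 ^ c" "n div 2 + 2 ^ c + (k - a + 1) \<le> 2 ^ t"
    and "\<And>v. v \<in> W a \<Longrightarrow> \<exists>e\<in>F. e \<subseteq> N v \<inter> W a"
  shows "win t F"
  using assms
proof (induction t arbitrary: a F)
  case 0
  then show ?case using n3 by auto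
next
  case (Suc t)
  note a = Suc.prems(2,3) and bound = Suc.prems(5)
  have n4: "4 \<le> n" using n3 \<open>even n\<close> by presburger
  have "t \<noteq> 0"
  proof
    assume "t = 0"
    then show False using bound n4 by auto
  qed
  \<comment> \<open>Writing \<open>2 ^ t\<close> as \<open>2 * z\<close> makes the parity and size
    conditions below linear.\<close>
  then obtain z :: nat where z: "2 ^ t = 2 * z" "0 < z" by (cases t) auto
  have edge: "\<exists>e\<in>residual x y F. e \<subseteq> N v \<inter> W a - {x}" if "v \<in> W a" "y \<notin> N v \<inter> W a - {x}" for x y v
  proof -
    obtain e where e: "e \<in> F" "e \<subseteq> N v \<inter> W a" using Suc.prems(6) \<open>v \<in> W a\<close> by blast
    then have "e - {x} \<in> residual x y F" using that by (intro residualI) auto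
    moreover have "e - {x} \<subseteq> N v \<inter> W a - {x}" using e by auto
    ultimately show ?thesis by (rule rev_bexI)
  qed
  have path: "win t (residual x y F)"
    if "inj_on w {c<..<d}" "c < d" "even (d - c)" "d - c \<le> 2 ^ t" "y \<notin> w ` {c<..<d}"
      and "\<And>i. c < i \<Longrightarrow> i < d \<Longrightarrow> odd (i - c) \<Longrightarrow>
        w i \<in> W a \<and> N (w i) \<inter> W a - {x} \<subseteq> w ` ({i - 1..i + 1} \<inter> {c<..<d})"
    for x y c d and w :: "nat \<Rightarrow> tadpole_vertex"
  proof (rule win_path[OF that(1-4)])
    fix i assume "c < i" "i < d" "odd (i - c)"
    note i = that(6)[OF this]
    then have "y \<notin> N (w i) \<inter> W a - {x}" using that(5) by blast
    then show "\<exists>e\<in>residual x y F. e \<subseteq> w ` ({i - 1..i + 1} \<inter> {c<..<d})"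
      using edge[of "w i" y x] i by (meson order_trans)
  qed
  consider "2 ^ t < k - a + 1" | "k - a + 1 \<le> 2 ^ t" "n \<le> 2 ^ t" | "k - a + 1 \<le> 2 ^ t" "2 ^ t < n"
    by linarith
  then show ?case
  proof cases
    case 1
    \<comment> \<open>The piece below \<open>U m\<close> is just short enough to be won in
      \<open>t\<close> rounds, and dropping it lowers the left side of the bound by exactly
      \<open>2 ^ t\<close>.\<close>
    define m where "m = a + 2 ^ t"
    have m: "a < m" "m < k" "odd (k - m)" "even (m - a)"
    proof -
      have "m = a + 2 * z" "0 < z" "2 * z < k - a + 1" using 1 z by (auto simp: m_def)
      then show "a < m" "m < k" "odd (k - m)" "even (m - a)" using a by presburger+
    qed
    have "win t (residual (U m) y F)" for y
    proof (cases "y \<in> U ` {a<..<m}")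
      case False
      then show ?thesis
      proof (rule_tac path)
        fix i assume i: "a < i" "i < m"
        show "U i \<in> W a \<and> N (U i) \<inter> W a - {U m} \<subseteq> U ` ({i - 1..i + 1} \<inter> {a<..<m})"
          using i m by (auto dest!: N_U_D)
      qed (use m in \<open>auto simp: m_def inj_on_def\<close>)
    next
      case True
      show ?thesis
      proof (rule Suc.IH[of m])
        show "n div 2 + 2 ^ c + (k - m + 1) \<le> 2 ^ t" using bound m by (auto simp: m_def)
        fix v assume v: "v \<in> W m"
        then have "v \<in> W a" using m by (auto simp: W_def)
        have "N v \<inter> W a - {U m} \<subseteq> N v \<inter> W m"
          using v
        proof (cases rule: W_cases)
          case (2 j)
          then show ?thesis using m n3 by (auto dest!: N_U_D)
        next
          case (1 i)
          have tail: "j = k" if "U j \<in> N (V i)" for j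
            using sym[OF that] by (auto dest!: N_U_D)
          show ?thesis using m 1 by (auto elim!: W_cases dest: tail)
        qed
        moreover from this have "y \<notin> N v \<inter> W a - {U m}" using True by auto
        ultimately show "\<exists>e\<in>residual (U m) y F. e \<subseteq> N v \<inter> W m"
          using edge[OF \<open>v \<in> W a\<close>, of y "U m"] by (meson order_trans)
      qed (use Suc.prems m in auto)
    qed
    then show ?thesis by auto
  next
    case 2
    have "win t (residual (V 0) y F)" for y
    proof (cases "y \<in> U ` {a<..<Suc k}")
      case False
      then show ?thesis
      proof (rule_tac path)
        fix i assume i: "a < i" "i < Suc k"
        show "U i \<in> W a \<and> N (U i) \<inter> W a - {V 0} \<subseteq> U ` ({i - 1..i + 1} \<inter> {a<..<Suc k})"
          using i by (auto dest!: N_U_D)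
      qed (use a 2 in \<open>auto simp: inj_on_def\<close>)
    next
      case True
      then have "y \<notin> V ` {0<..<n}" by auto
      then show ?thesis
      proof (rule_tac path)
        fix i assume i: "0 < i" "i < n"
        show "V i \<in> W a \<and> N (V i) \<inter> W a - {V 0} \<subseteq> V ` ({i - 1..i + 1} \<inter> {0<..<n})"
          using i by (auto dest!: N_V_D)
      qed (use \<open>even n\<close> n3 2 in \<open>auto simp: inj_on_def\<close>)
    qed
    then show ?thesis by auto
  next
    case 3
    \<comment> \<open>From \<open>2 ^ t < n\<close> and \<open>n \<le> 2 * 2 ^ c\<close> follows
      \<open>t \<le> c\<close>, so \<open>2 ^ c\<close> uses up at least half of the budget
      \<open>2 * 2 ^ t\<close> and the other terms fit into \<open>2 ^ t\<close>.\<close>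
    have "z < 2 ^ c" using 3 z Suc.prems(4) by linarith
    then have "2 ^ t < (2::nat) ^ Suc c" using z by simp
    then have "t \<le> c" by (simp del: power_Suc)
    then have "(2::nat) ^ t \<le> 2 ^ c" by simp
    then have bound': "n div 2 + (k - a + 1) \<le> 2 ^ t" using bound unfolding power_Suc by linarith
    \<comment> \<open>The largest even number up to \<open>n div 2\<close>; evenness gives both
      paths an odd number of vertices.\<close>
    define i where "i = 2 * (n div 2 div 2)"
    have n: "n = 2 * (n div 2)" using \<open>even n\<close> by simp
    have "4 \<le> n div 2" using bound' 3 a n unfolding z(1) by presburger
    then have i: "even i" "4 \<le> i" "i + 4 \<le> n" "i \<le> n div 2"
      using n by (auto simp: i_def)
    have i': "k - a + 1 + (n - i) \<le> 2 ^ t"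
    proof -
      \<comment> \<open>If \<open>n div 2\<close> is odd, then \<open>n - i\<close> exceeds it by
        one; since \<open>k - a + 1\<close> and \<open>2 ^ t\<close> are even, \<open>bound'\<close>
        is then strict and absorbs this unit.\<close>
      have "even (k - a + 1)" using a by simp
      then obtain b where b: "k - a + 1 = 2 * b" by (rule evenE)
      obtain h r where h: "n div 2 = 2 * h + r" "h = n div 2 div 2" "r < 2"
        by (metis mod_less_divisor mult_div_mod_eq pos2)
      then have "n - i = 2 * h + 2 * r" using n unfolding i_def by linarith
      moreover have "2 * h + r + 2 * b \<le> 2 * z" using bound' unfolding h(1) b z(1) by simp
      ultimately show ?thesis using h(3) unfolding b z(1) by presburger
    qed
    have i'': "k - a + 1 + i \<le> 2 ^ t" using bound' i by linarith
    have "win t (residual (V i) y F)" for y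
    proof -
      consider "y \<notin> fwd ` {a<..<Suc k + i}" | "y \<notin> bwd ` {a<..<Suc k + (n - i)}"
        | "y \<in> fwd ` {a<..<Suc k + i}" "y \<in> bwd ` {a<..<Suc k + (n - i)}" by blast
      then show ?thesis
      proof cases
        case 1
        then show ?thesis
        proof (rule_tac path)
          fix q assume q: "a < q" "q < Suc k + i" "odd (q - a)"
          show "fwd q \<in> W a \<and> N (fwd q) \<inter> W a - {V i} \<subseteq> fwd ` ({q - 1..q + 1} \<inter> {a<..<Suc k + i})"
          proof (cases "q \<le> k")
            case True
            have "U j \<in> fwd ` ({q - 1..q + 1} \<inter> {a<..<Suc k + i})"
              if "a < j" "q - 1 \<le> j" "j \<le> q + 1" "j \<le> k" for j
              using that by (intro image_eqI[of _ _ j]) (auto simp: fwd_def)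
            moreover have "V 0 \<in> fwd ` ({q - 1..q + 1} \<inter> {a<..<Suc k + i})" if "q = k"
              using that q i by (intro image_eqI[of _ _ "Suc k"]) (auto simp: fwd_def)
            ultimately show ?thesis using q True
              by (auto simp: fwd_def dest!: N_U_D)
          next
            case False
            define l where "l = q - Suc k"
            \<comment> \<open>Parity excludes \<open>q = Suc k\<close>, so nothing is claimed about
              the neighbourhood of \<open>V 0\<close>, which does not fit on the path.\<close>
            have l: "q = Suc k + l" "0 < l" "l < i"
              using False q a by (auto simp: l_def) presburger+
            define I where "I = fwd ` ({q - 1..q + 1} \<inter> {a<..<Suc k + i})"
            have I: "V j \<in> I" if "l \<le> j + 1" "j \<le> l + 1" "j < i" for j
              unfolding I_def using that l a
              by (intro image_eqI[of _ _ "Suc k + j"]) (auto simp: fwd_def)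
            have "x \<in> I" if x: "x \<in> N (V l)" "x \<noteq> V i" for x
            proof -
              have "V (l - 1) \<in> I" "V l \<in> I" "Suc l \<noteq> i \<Longrightarrow> V (Suc l) \<in> I"
                using l by (auto intro!: I)
              then show ?thesis using N_V_D[OF x(1)] x(2) l i by auto
            qed
            moreover have "fwd q = V l" using l by (simp add: fwd_def)
            ultimately show ?thesis using l i unfolding I_def[symmetric] by auto
          qed
        qed (use a i i'' in \<open>auto simp: inj_fwd\<close>)
      next
        case 2
        then show ?thesis
        proof (rule_tac path)
          fix q assume q: "a < q" "q < Suc k + (n - i)" "odd (q - a)"
          show "bwd q \<in> W a \<and>
              N (bwd q) \<inter> W a - {V i} \<subseteq> bwd ` ({q - 1..q + 1} \<inter> {a<..<Suc k + (n - i)})"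
          proof (cases "q \<le> k")
            case True
            have "U j \<in> bwd ` ({q - 1..q + 1} \<inter> {a<..<Suc k + (n - i)})"
              if "a < j" "q - 1 \<le> j" "j \<le> q + 1" "j \<le> k" for j
              using that by (intro image_eqI[of _ _ j]) (auto simp: bwd_def)
            moreover have "V 0 \<in> bwd ` ({q - 1..q + 1} \<inter> {a<..<Suc k + (n - i)})" if "q = k"
              using that q i by (intro image_eqI[of _ _ "Suc k"]) (auto simp: bwd_def)
            ultimately show ?thesis using q True
              by (auto simp: bwd_def dest!: N_U_D)
          next
            case False
            define l where "l = q - Suc k"
            have l: "q = Suc k + l" "0 < l" "l < n - i"
              using False q a by (auto simp: l_def) presburger+
            define I where "I = bwd ` ({q - 1..q + 1} \<inter> {a<..<Suc k + (n - i)})"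
            have I: "V ((n - j) mod n) \<in> I" if "l \<le> j + 1" "j \<le> l + 1" "j < n - i" for j
              unfolding I_def using that l a
              by (intro image_eqI[of _ _ "Suc k + j"]) (auto simp: bwd_def)
            have "x \<in> I" if x: "x \<in> N (V (n - l))" "x \<noteq> V i" for x
            proof -
              have "V (Suc (n - l) mod n) \<in> I" using I[of "l - 1"] l by (simp add: Suc_diff_le)
              moreover have "V (n - l) \<in> I" using I[of l] l by simp
              moreover have "V (n - l - 1) \<in> I" if "n - l - 1 \<noteq> i" using I[of "Suc l"] l that by simp
              moreover have "l < n" using l by simp
              ultimately show ?thesis using N_V_D[OF x(1)] x(2) l i by auto
            qed
            moreover have "bwd q = V (n - l)" using l bwd_Suc[of l] by simp
            ultimately show ?thesis using l i unfolding I_def[symmetric] by auto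
          qed
        qed (use a i i' \<open>even n\<close> in \<open>auto intro!: inj_on_subset[OF inj_bwd]\<close>)
      next
        case 3
        then have "y \<in> U ` {a<..k} \<union> V ` {0..<i}" "y \<in> U ` {a<..k} \<union> {V 0} \<union> V ` {i<..<n}"
          using fwd_image[of a i] bwd_image[of a i] a i by auto
        \<comment> \<open>The paths share only the tail and \<open>V 0\<close>, so this reply leaves
          both arcs untouched, and taking \<open>V (i - 1)\<close> threatens to complete the
          neighbourhoods of \<open>V i\<close> and of \<open>V (i - 1)\<close>.\<close>
        then have y: "y \<notin> V ` {0<..<n}" by auto
        have "win 2 {{V (i - 1), V (Suc i)}, {V (i - 1), V (i - 2)}}"
          using i by (intro win_double_threat[of "V (i - 1)" "V (Suc i)" _ "V (i - 2)"]) auto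
        then have "win 2 (residual (V i) y F)"
        proof (rule win_mono)
          fix e assume e: "e \<in> {{V (i - 1), V (Suc i)}, {V (i - 1), V (i - 2)}}"
          have "N (V i) \<inter> W a - {V i} \<subseteq> {V (i - 1), V (Suc i)}"
            "N (V (i - 1)) \<inter> W a - {V i} \<subseteq> {V (i - 1), V (i - 2)}"
            using i by (auto dest!: N_V_D simp: numeral_2_eq_2)
          moreover have "V i \<in> W a" "V (i - 1) \<in> W a" using i by auto
          ultimately have "\<exists>v\<in>W a. N v \<inter> W a - {V i} \<subseteq> e"
            using e by (metis insertE singletonD)
          then obtain v where v: "v \<in> W a" "N v \<inter> W a - {V i} \<subseteq> e" by blast
          moreover have "y \<notin> e" using e y i by auto
          ultimately show "\<exists>e'\<in>residual (V i) y F. e' \<subseteq> e"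
            using edge[of v y "V i"] by (meson order_trans subsetD)
        qed
        moreover have "2 \<le> t" using i'' i z by (cases t; cases "t - 1") auto
        ultimately show ?thesis by (rule win_le)
      qed
    qed
    then show ?thesis by auto
  qed
qed

section \<open>Dominator's defence on the tadpole\<close>

text \<open>
  The premise on \<open>P\<close> holds for the least power of two that is at least \<open>n / 2\<close>. Staller's first
  move either leaves a graph with a perfect matching, which is lost for her, or splits the graph
  into two parts of which Dominator can neutralise whichever he likes by replying next to it.
\<close>

lemma win_tadpole_imp_le:
  assumes n: "even n" and P: "\<And>j. n \<le> 2 * 2 ^ j \<Longrightarrow> P \<le> 2 ^ j"
    and "a < k" "odd (k - a)" "win t (nbhds (W a))"
  shows "n div 2 + P + (k - a + 1) \<le> 2 ^ t"
  using assms(3-)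
proof (induction t arbitrary: a)
  case 0
  then show ?case using not_win_0 by blast
next
  case (Suc t)
  note a = Suc.prems(1,2)
  obtain x where x: "\<And>y. win t (residual x y (nbhds (W a)))" using Suc.prems(3) by auto
  have n2: "n = 2 * (n div 2)" using n by simp
  show ?case
  proof (cases "x \<in> W a")
    case False
    then have "n div 2 + P + (k - a + 1) \<le> 2 ^ t" using Suc.IH[OF a] win_pass[OF x] by blast
    then show ?thesis by simp
  next
    case True
    then show ?thesis
    proof (cases rule: W_cases)
      case U: (2 m)
      show ?thesis
      proof (cases "even (m - a)")
        case True
        have m: "Suc a < m" "m < k" "odd (k - m)" using True U(2,3) a by presburger+
        \<comment> \<open>A reply towards the free end leaves the shorter tadpole; the reply towards
          the cycle, below, leaves only the severed piece of the tail. Staller must win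
          both.\<close>
        have "win t (nbhds (W m))"
        proof (rule win_reply[OF x[of "U (m - 1)"], where M = "U ` {Suc a..<m - 1}"])
          show "U (m - 1) \<in> N x" using sym[OF N_U_Suc[of "m - 1"]] m U by simp
          show "matched (U ` {Suc a..<m - 1})" using True m by (intro matched_U) auto
          show "W a \<subseteq> U ` {Suc a..<m - 1} \<union> W m \<union> N (U (m - 1))"
          proof
            fix v assume "v \<in> W a"
            then show "v \<in> U ` {Suc a..<m - 1} \<union> W m \<union> N (U (m - 1))"
            proof (cases rule: W_cases)
              case (2 j)
              consider "j < m - 1" | "j = m - 1" | "j = m" | "j > m" by linarith
              then show ?thesis using 2 self N_U_Suc[of "m - 1"] m by cases auto
            qed simp
          qed
        qed (use m U in \<open>auto elim!: W_cases\<close>)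
        then have "n div 2 + P + (k - m + 1) \<le> 2 ^ t" using m by (intro Suc.IH) auto
        moreover have "win t (nbhds (U ` {a<..<m}))"
        proof (rule win_reply[OF x[of "U (Suc m)"],
              where M = "V ` {0..<n} \<union> U ` {Suc (Suc m)..<Suc k}"])
          show "U (Suc m) \<in> N x" using N_U_Suc[of m] m U by simp
          show "matched (V ` {0..<n} \<union> U ` {Suc (Suc m)..<Suc k})"
            using n m by (intro matched_Un matched_V matched_U) auto
          show "W a \<subseteq> V ` {0..<n} \<union> U ` {Suc (Suc m)..<Suc k} \<union> U ` {a<..<m} \<union> N (U (Suc m))"
          proof
            fix v assume "v \<in> W a"
            then show "v \<in> V ` {0..<n} \<union> U ` {Suc (Suc m)..<Suc k} \<union> U ` {a<..<m} \<union> N (U (Suc m))"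
            proof (cases rule: W_cases)
              case (2 j)
              consider "j < m" | "j = m" | "j = Suc m" | "j > Suc m" by linarith
              then show ?thesis using 2 self sym[OF N_U_Suc[of m]] m by cases auto
            qed simp
          qed
        qed (use m U in auto)
        then have "m - a \<le> 2 ^ t"
          using m True N_U_Suc by (intro win_path_imp_le[of U]) (auto simp: inj_on_def)
        ultimately show ?thesis using m by simp
      next
        case odd: False
        have False
        proof (cases "m = k")
          case True
          \<comment> \<open>The reply \<open>V 0\<close> takes care of \<open>U k\<close>,
            \<open>V 0\<close> and \<open>V 1\<close>; an even number of vertices is left on the
            tail and on the cycle.\<close>
          show False
          proof (rule win_reply_matched[OF x[of "V 0"],
                where M = "U ` {Suc a..<k} \<union> V ` {2..<n}"])
            show "V 0 \<in> N x" using N_U_last U True by simp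
            show "matched (U ` {Suc a..<k} \<union> V ` {2..<n})"
              using n a by (intro matched_Un matched_V matched_U) auto
            show "W a \<subseteq> U ` {Suc a..<k} \<union> V ` {2..<n} \<union> N (V 0)"
            proof
              fix v assume "v \<in> W a"
              then show "v \<in> U ` {Suc a..<k} \<union> V ` {2..<n} \<union> N (V 0)"
              proof (cases rule: W_cases)
                case (1 i)
                consider "i = 0" | "i = 1" | "i \<ge> 2" by linarith
                then show ?thesis using 1 self N_V_Suc[of 0] by cases auto
              next
                case (2 j)
                then show ?thesis using sym[OF N_U_last] by (cases "j = k") auto
              qed
            qed
          qed (use U True n3 a in auto)
        next
          case False
          then have m: "Suc (Suc m) \<le> k" "even (k - m)" using odd U(2,3) a by presburger+
          show False
          proof (rule win_reply_matched[OF x[of "U (Suc m)"],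
                where M = "U ` {Suc a..<m} \<union> (V ` {0..<n} \<union> U ` {Suc (Suc (Suc m))..<Suc k})"])
            show "U (Suc m) \<in> N x" using N_U_Suc[of m] m U by simp
            show "matched (U ` {Suc a..<m} \<union> (V ` {0..<n} \<union> U ` {Suc (Suc (Suc m))..<Suc k}))"
              using n odd U m by (intro matched_Un matched_V matched_U) auto
            show "W a \<subseteq> U ` {Suc a..<m} \<union> (V ` {0..<n} \<union> U ` {Suc (Suc (Suc m))..<Suc k}) \<union>
                N (U (Suc m))"
            proof
              fix v assume "v \<in> W a"
              then show "v \<in> U ` {Suc a..<m} \<union> (V ` {0..<n} \<union> U ` {Suc (Suc (Suc m))..<Suc k}) \<union>
                N (U (Suc m))"
              proof (cases rule: W_cases)
                case (2 j)
                consider "j < m" | "j = m" | "j = Suc m" | "j = Suc (Suc m)" | "j > Suc (Suc m)"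
                  by linarith
                then show ?thesis using 2 self sym[OF N_U_Suc[of m]] N_U_Suc[of "Suc m"] m
                  by cases auto
              qed simp
            qed
          qed (use m U in auto)
        qed
        then show ?thesis ..
      qed
    next
      case V: (1 i)
      consider "i = 0" | "even i" "2 \<le> i" | "i = 1" | "odd i" "3 \<le> i"
      proof -
        have "i = 0 \<or> even i \<and> 2 \<le> i \<or> i = 1 \<or> odd i \<and> 3 \<le> i" by presburger
        then show thesis using that by blast
      qed
      then show ?thesis
      proof cases
        case 1
        have "win t (nbhds (U ` {a<..<Suc k}))"
        proof (rule win_reply[OF x[of "V 1"], where M = "V ` {2..<n}"])
          show "V 1 \<in> N x" using N_V_Suc[of 0] V 1 n3 by simp
          show "matched (V ` {2..<n})" using n by (intro matched_V) auto
          show "W a \<subseteq> V ` {2..<n} \<union> U ` {a<..<Suc k} \<union> N (V 1)"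
          proof
            fix v assume "v \<in> W a"
            then show "v \<in> V ` {2..<n} \<union> U ` {a<..<Suc k} \<union> N (V 1)"
            proof (cases rule: W_cases)
              case (1 i)
              consider "i = 0" | "i = 1" | "i \<ge> 2" by linarith
              then show ?thesis using 1 self sym[OF N_V_Suc[of 0]] n3 by cases auto
            qed auto
          qed
        qed (use V 1 n3 in auto)
        then have k: "Suc k - a \<le> 2 ^ t"
          using a N_U_Suc by (intro win_path_imp_le[of U]) (auto simp: inj_on_def)
        have "win t (nbhds (V ` {0<..<n}))"
        proof (rule win_reply[OF x[of "U k"], where M = "U ` {Suc a..<k}"])
          show "U k \<in> N x" using sym[OF N_U_last] V 1 by simp
          show "matched (U ` {Suc a..<k})" using a by (intro matched_U) auto
          show "W a \<subseteq> U ` {Suc a..<k} \<union> V ` {0<..<n} \<union> N (U k)"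
          proof
            fix v assume "v \<in> W a"
            then show "v \<in> U ` {Suc a..<k} \<union> V ` {0<..<n} \<union> N (U k)"
            proof (cases rule: W_cases)
              case (1 i)
              then show ?thesis using N_U_last by (cases "i = 0") auto
            next
              case (2 j)
              then show ?thesis using self by (cases "j = k") auto
            qed
          qed
        qed (use V 1 a in auto)
        then have nt: "n \<le> 2 ^ t"
          using n n3 N_V_Suc win_path_imp_le[of V 0 n t] by (auto simp: inj_on_def)
        then obtain t' where t': "t = Suc t'" using n3 by (cases t) auto
        \<comment> \<open>\<open>n \<le> 2 ^ t\<close> allows the premise on \<open>P\<close> to be
          used one exponent lower, so \<open>n div 2\<close> and \<open>P\<close> together stay
          within \<open>2 ^ t\<close>.\<close>
        then have "P \<le> 2 ^ t'" using nt by (intro P) auto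
        then show ?thesis using nt k n2 a(1) unfolding t' power_Suc by linarith
      next
        case 2
        have "win t (nbhds (fwd ` {a<..<Suc k + i}))"
        proof (rule win_reply[OF x[of "V (Suc i)"], where M = "V ` {Suc (Suc i)..<n}"])
          have i: "Suc i < n" using V(2) 2 n by presburger
          show "V (Suc i) \<in> N x" using N_V_Suc i V by simp
          show "matched (V ` {Suc (Suc i)..<n})" using n 2 by (intro matched_V) auto
          show "W a \<subseteq> V ` {Suc (Suc i)..<n} \<union> fwd ` {a<..<Suc k + i} \<union> N (V (Suc i))"
          proof
            fix v assume "v \<in> W a"
            then show "v \<in> V ` {Suc (Suc i)..<n} \<union> fwd ` {a<..<Suc k + i} \<union> N (V (Suc i))"
              unfolding fwd_image[OF less_imp_le[OF a(1)]]
            proof (cases rule: W_cases)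
              case (1 j)
              consider "j < i" | "j = i" | "j = Suc i" | "j > Suc i" by linarith
              then show "v \<in> V ` {Suc (Suc i)..<n} \<union> (U ` {a<..k} \<union> V ` {0..<i}) \<union> N (V (Suc i))"
                using 1 self sym[OF N_V_Suc[of i]] i by cases auto
            qed auto
          qed
          show "V (Suc i) \<in> W a" using i by simp
        qed (use V a in \<open>auto simp: fwd_image simp del: add_Suc\<close>)
        then have 1: "Suc k + i - a \<le> 2 ^ t"
          using a 2 V by (intro win_path_imp_le[of fwd]) (auto intro: inj_fwd fwd_adj)
        have "win t (nbhds (bwd ` {a<..<Suc k + (n - i)}))"
        proof (rule win_reply[OF x[of "V (i - 1)"], where M = "V ` {1..<i - 1}"])
          show "V (i - 1) \<in> N x" using sym[OF N_V_Suc[of "i - 1"]] V 2 by simp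
          show "matched (V ` {1..<i - 1})" using V 2 by (intro matched_V) auto
          have img: "bwd ` {a<..<Suc k + (n - i)} = U ` {a<..k} \<union> {V 0} \<union> V ` {i<..<n}"
            using a V 2 by (intro bwd_image) auto
          show "W a \<subseteq> V ` {1..<i - 1} \<union> bwd ` {a<..<Suc k + (n - i)} \<union> N (V (i - 1))"
          proof
            fix v assume "v \<in> W a"
            then show "v \<in> V ` {1..<i - 1} \<union> bwd ` {a<..<Suc k + (n - i)} \<union> N (V (i - 1))"
              unfolding img
            proof (cases rule: W_cases)
              case (1 j)
              consider "j = 0" | "0 < j" "j < i - 1" | "j = i - 1" | "j = i" | "j > i" by linarith
              then show "v \<in> V ` {1..<i - 1} \<union> (U ` {a<..k} \<union> {V 0} \<union> V ` {i<..<n}) \<union> N (V (i - 1))"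
                using 1 self N_V_Suc[of "i - 1"] 2 by cases auto
            qed auto
          qed
          show "V ` {1..<i - 1} \<inter> bwd ` {a<..<Suc k + (n - i)} = {}" unfolding img by auto
          show "bwd ` {a<..<Suc k + (n - i)} \<subseteq> W a" unfolding img using n3 by auto
          show "x \<notin> bwd ` {a<..<Suc k + (n - i)}" unfolding img using V 2 by auto
        qed (use V 2 in auto)
        moreover have "inj_on bwd {a<..<Suc k + (n - i)}"
          by (rule inj_on_subset[OF inj_bwd]) auto
        ultimately have "Suc k + (n - i) - a \<le> 2 ^ t"
          using a 2 V n by (intro win_path_imp_le[of bwd]) (auto intro: bwd_adj)
        then have "k - a + 1 + (n - i) \<le> 2 ^ t" using a(1) by simp
        moreover have "k - a + 1 + i \<le> 2 ^ t" using 1 a(1) by simp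
        \<comment> \<open>The tail and \<open>V 0\<close> lie on both paths and count twice, which
          produces \<open>n + 2 * (k - a + 1)\<close>.\<close>
        ultimately have "(k - a + 1 + (n - i)) + (k - a + 1 + i) \<le> 2 ^ t + 2 ^ t" by (rule add_mono)
        moreover have "(k - a + 1 + (n - i)) + (k - a + 1 + i) = n + 2 * (k - a + 1)" using V(2) by simp
        ultimately have sum: "n + 2 * (k - a + 1) \<le> 2 * 2 ^ t" by simp
        then have "P \<le> 2 ^ t" by (intro P) simp
        moreover have "2 * (n div 2 + (k - a + 1)) \<le> 2 * 2 ^ t"
          using sum unfolding distrib_left n2[symmetric] .
        then have "n div 2 + (k - a + 1) \<le> 2 ^ t" by simp
        ultimately show ?thesis unfolding power_Suc by linarith
      next
        case 3
        have False
        proof (rule win_reply_matched[OF x[of "V 0"],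
              where M = "U ` {Suc a..<k} \<union> V ` {2..<n}"])
          show "V 0 \<in> N x" using sym[OF N_V_Suc[of 0]] V 3 by simp
          show "matched (U ` {Suc a..<k} \<union> V ` {2..<n})"
            using n a by (intro matched_Un matched_V matched_U) auto
          show "W a \<subseteq> U ` {Suc a..<k} \<union> V ` {2..<n} \<union> N (V 0)"
          proof
            fix v assume "v \<in> W a"
            then show "v \<in> U ` {Suc a..<k} \<union> V ` {2..<n} \<union> N (V 0)"
            proof (cases rule: W_cases)
              case (1 i)
              consider "i = 0" | "i = 1" | "i \<ge> 2" by linarith
              then show ?thesis using 1 self N_V_Suc[of 0] by cases auto
            next
              case (2 j)
              then show ?thesis using sym[OF N_U_last] by (cases "j = k") auto
            qed
          qed
        qed (use V 3 n3 in auto)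
        then show ?thesis ..
      next
        case 4
        \<comment> \<open>The reply \<open>V (i - 1)\<close> dominates itself and its two
          neighbours; the rest falls into the tail with \<open>V 0\<close> and two arcs, all of even
          size.\<close>
        have False
        proof (rule win_reply_matched[OF x[of "V (i - 1)"],
              where M = "insert (V 0) (U ` {a<..k}) \<union> (V ` {1..<i - 2} \<union> V ` {Suc i..<n})"])
          show "V (i - 1) \<in> N x" using sym[OF N_V_Suc[of "i - 1"]] V 4 by simp
          show "matched (insert (V 0) (U ` {a<..k}) \<union> (V ` {1..<i - 2} \<union> V ` {Suc i..<n}))"
            using n a V 4 by (intro matched_Un matched_V matched_U_V0) auto
          show "W a \<subseteq> insert (V 0) (U ` {a<..k}) \<union> (V ` {1..<i - 2} \<union> V ` {Suc i..<n}) \<union> N (V (i - 1))"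
          proof
            fix v assume "v \<in> W a"
            then show "v \<in> insert (V 0) (U ` {a<..k}) \<union> (V ` {1..<i - 2} \<union> V ` {Suc i..<n}) \<union> N (V (i - 1))"
            proof (cases rule: W_cases)
              case (1 j)
              have e: "Suc (i - 2) = i - 1" "Suc (i - 1) = i" using 4 by auto
              have adj: "V (i - 2) \<in> N (V (i - 1))" "V i \<in> N (V (i - 1))"
                using sym[OF N_V_Suc[of "i - 2"]] N_V_Suc[of "i - 1"] V unfolding e by auto
              consider "j = 0" | "0 < j" "j < i - 2" | "j = i - 2" | "j = i - 1" | "j = i" | "j > i"
                by linarith
              then show ?thesis using 1 self adj by cases auto
            qed auto
          qed
        qed (use V 4 n3 in auto)
        then show ?thesis ..
      qed
    qed
  qed
qed

section \<open>Games in which Staller cannot win\<close>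

lemma not_win_odd_cycle:
  assumes n: "odd n"
  shows "\<not> win t (nbhds (V ` {0..<n}))"
proof (induction t)
  case 0
  then show ?case by (rule not_win_0)
next
  case (Suc t)
  let ?C = "V ` {0..<n}"
  show ?case
  proof
    assume "win (Suc t) (nbhds ?C)"
    then obtain x where x: "\<And>y. win t (residual x y (nbhds ?C))" by auto
    show False
    proof (cases "x \<in> ?C")
      case False
      then show False using win_pass[OF x] Suc by blast
    next
      case True
      then obtain i where i: "x = V i" "i < n" by auto
      \<comment> \<open>The cycle is renumbered to start at Staller's vertex. The reply
        \<open>w 1\<close> dominates \<open>w 0\<close>, \<open>w 1\<close> and \<open>w 2\<close>,
        and the other \<open>n - 3\<close> vertices form an even path.\<close>
      define w where "w j = V ((i + j) mod n)" for j
      have w: "w j \<in> ?C" for j using n3 by (simp add: w_def)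
      have adj: "w (Suc j) \<in> N (w j)" for j
      proof -
        have "(i + Suc j) mod n = (if Suc ((i + j) mod n) = n then 0 else Suc ((i + j) mod n))"
          by (simp add: mod_Suc)
        moreover have "(i + j) mod n < n" using n3 by simp
        moreover have "(i + j) mod n = n - Suc 0" if "Suc ((i + j) mod n) = n" using that by simp
        ultimately show ?thesis using N_V_Suc[of "(i + j) mod n"] N_V_wrap
          by (cases "Suc ((i + j) mod n) = n") (simp_all add: w_def)
      qed
      have inj: "inj_on w {0..<n}"
      proof (rule inj_onI)
        fix p q assume pq: "p \<in> {0..<n}" "q \<in> {0..<n}" "w p = w q"
        then have "(i + p) mod n = (i + q) mod n" by (simp add: w_def)
        moreover have "(i + j) mod n = (if i + j < n then i + j else i + j - n)" if "j < n" for j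
          using that i by (simp add: mod_if)
        ultimately show "p = q" using pq by (auto split: if_splits)
      qed
      have surj: "w ` {0..<n} = ?C"
      proof (rule card_subset_eq)
        show "card (w ` {0..<n}) = card ?C" using inj by (simp add: card_image inj_on_def)
      qed (use w in auto)
      have w0: "x = w 0" using i by (simp add: w_def)
      show False
      proof (rule win_reply_matched[OF x[of "w 1"], where M = "w ` {3..<n}"])
        show "w 1 \<in> N x" using adj[of 0] w0 by simp
        show "w 1 \<noteq> x" using inj_onD[OF inj, of 1 0] n3 w0 by auto
        show "matched (w ` {3..<n})"
          using n n3 adj by (intro matched_path) (auto intro: inj_on_subset[OF inj])
        show "x \<notin> w ` {3..<n}" using w0 by (auto dest!: inj_onD[OF inj])
        show "?C \<subseteq> w ` {3..<n} \<union> N (w 1)"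
        proof
          fix v assume "v \<in> ?C"
          then obtain j where j: "v = w j" "j < n" unfolding surj[symmetric] by auto
          consider "j = 0" | "j = 1" | "j = 2" | "j \<ge> 3" by linarith
          then show "v \<in> w ` {3..<n} \<union> N (w 1)"
            using j self sym[OF adj[of 0]] adj[of 1] by cases (auto simp: numeral_2_eq_2)
        qed
      qed (use w in auto)
    qed
  qed
qed

lemma not_pos_Dominator_tadpole: "\<not> pos Dominator t (nbhds (W 0))"
proof (rule not_pos_Dominator)
  \<comment> \<open>\<open>V 1\<close> and \<open>U k\<close> are dominated by \<open>V 0\<close>,
    so each is left out exactly when its path would otherwise be odd.\<close>
  define p where "p = (if even n then 2 else 1 :: nat)"
  define q where "q = (if even k then Suc k else k)"
  let ?M = "V ` {p..<n} \<union> U ` {1..<q}"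
  show "matched ?M"
    by (intro matched_Un matched_V matched_U) (use k1 in \<open>auto simp: p_def q_def\<close>)
  show "?M \<subseteq> W 0" by (auto simp: q_def split: if_splits)
  show "W 0 \<subseteq> ?M \<union> N (V 0)"
  proof
    fix v assume "v \<in> W 0"
    then show "v \<in> ?M \<union> N (V 0)"
    proof (cases rule: W_cases)
      case (1 i)
      consider "i = 0" | "i = 1" | "i \<ge> 2" by linarith
      then show ?thesis using 1 self N_V_Suc[of 0] by cases (auto simp: p_def)
    next
      case (2 j)
      then show ?thesis using sym[OF N_U_last] by (cases "j = k") (auto simp: q_def)
    qed
  qed
qed (use n3 in simp)

text \<open>If \<open>n\<close> and \<open>k\<close> have the same parity there is a perfect
  matching. For \<open>n\<close> odd and \<open>k\<close> even, ignoring the edge between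
  \<open>U k\<close> and \<open>V 0\<close> favours Staller and still leaves her a paired tail and
  an odd cycle.\<close>

lemma not_win_tadpole:
  assumes "\<not> (even n \<and> odd k)"
  shows "\<not> win t (nbhds (W 0))"
proof
  assume win: "win t (nbhds (W 0))"
  consider "even n" "even k" | "odd n" "odd k" | "odd n" "even k" using assms by blast
  then show False
  proof cases
    case 1
    then have "matched (V ` {0..<n} \<union> U ` {1..<Suc k})"
      by (intro matched_Un matched_V matched_U) auto
    moreover have "V ` {0..<n} \<union> U ` {1..<Suc k} = W 0" by (auto simp: W_def)
    ultimately show False using not_win_matched win by metis
  next
    case 2
    then have "matched (insert (V 0) (U ` {0<..k}) \<union> V ` {1..<n})"
      by (intro matched_Un matched_V matched_U_V0) auto
    moreover have "insert (V 0) (U ` {0<..k}) \<union> V ` {1..<n} = W 0"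
    proof -
      have "{0..<n} = insert 0 {1..<n}" using n3 by auto
      then show ?thesis unfolding W_def by auto
    qed
    ultimately show False using not_win_matched win by metis
  next
    case 3
    have "win t (nbhds (U ` {1..<Suc k}) \<union> nbhds (V ` {0..<n}))"
    proof (rule win_mono[OF win])
      fix e assume "e \<in> nbhds (W 0)"
      then obtain v where v: "v \<in> W 0" "e = N v \<inter> W 0" by (auto simp: nbhds_def)
      from v(1) have "v \<in> U ` {1..<Suc k} \<or> v \<in> V ` {0..<n}" by (cases rule: W_cases) auto
      then obtain Q where Q: "Q = U ` {1..<Suc k} \<or> Q = V ` {0..<n}" "v \<in> Q" by blast
      then have "Q \<subseteq> W 0" by auto
      then have "N v \<inter> Q \<subseteq> e" using v by blast
      moreover have "N v \<inter> Q \<in> nbhds (U ` {1..<Suc k}) \<union> nbhds (V ` {0..<n})"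
        using Q by (auto simp: nbhds_def)
      ultimately show "\<exists>e'\<in>nbhds (U ` {1..<Suc k}) \<union> nbhds (V ` {0..<n}). e' \<subseteq> e" by blast
    qed
    moreover have "matched (U ` {1..<Suc k})" using 3 by (intro matched_U) auto
    ultimately have "win t (nbhds (V ` {0..<n}))"
      by (rule_tac win_matched) (auto simp: nbhds_def)
    then show False using not_win_odd_cycle 3 by blast
  qed
qed

lemma staller_wins_within_tadpole:
  "staller_wins_within first (tadpole n k) t \<longleftrightarrow> pos first t (nbhds (W 0))"
proof -
  have "pverts (tadpole n k) = W 0" by (auto simp: tadpole_def W_def)
  then have "finite (pverts (tadpole n k))" "\<Union>(N ` pverts (tadpole n k)) \<subseteq> pverts (tadpole n k)"
    unfolding closed_nbhd_tadpole by (auto simp: W_def nbhds_def)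
  then show ?thesis
    using pos_imp_staller_wins_within staller_wins_within_imp_pos closed_nbhd_tadpole by metis
qed

end

section \<open>From powers of two to the logarithmic formula\<close>

lemma ceiling_log2_le_iff:
  assumes "0 < m"
  shows "nat \<lceil>log 2 (real m)\<rceil> \<le> t \<longleftrightarrow> m \<le> 2 ^ t"
proof -
  have "nat \<lceil>log 2 (real m)\<rceil> \<le> t \<longleftrightarrow> log 2 (real m) \<le> real t"
    by (simp add: nat_le_iff ceiling_le_iff)
  also have "\<dots> \<longleftrightarrow> real m \<le> 2 powr real t" using assms by (simp add: log_le_iff)
  also have "\<dots> \<longleftrightarrow> real m \<le> real (2 ^ t)" by (simp add: powr_realpow)
  finally show ?thesis by (simp only: of_nat_le_iff)
qed

lemma SMB_number_eqI:
  assumes "\<And>t. staller_wins_within first G t \<longleftrightarrow> l \<le> t"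
  shows "SMB_number first G = enat l"
  unfolding SMB_number_def
proof (rule antisym)
  show "Inf {enat k | k. staller_wins_within first G k} \<le> enat l"
    using assms by (intro Inf_lower) auto
  show "enat l \<le> Inf {enat k | k. staller_wins_within first G k}"
    using assms by (intro Inf_greatest) auto
qed

lemma SMB_number_infinity:
  assumes "\<And>t. \<not> staller_wins_within first G t"
  shows "SMB_number first G = \<infinity>"
  using assms by (simp add: SMB_number_def top_enat_def[symmetric])

theorem theorem6p2:
  fixes n k :: nat
  assumes "n \<ge> 3" and "k \<ge> 1"
  shows "gamma_SMB (tadpole n k) = \<infinity> \<and>
    gamma_SMB' (tadpole n k) =
      (if even n \<and> odd k
       then enat (nat \<lceil>log 2 (real n + real k + tadpole_sigma n)\<rceil>)
       else \<infinity>)"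
proof -
  interpret tadpole_game n k using assms by unfold_locales
  have "gamma_SMB (tadpole n k) = \<infinity>"
    unfolding gamma_SMB_def
    by (intro SMB_number_infinity) (simp add: staller_wins_within_tadpole not_pos_Dominator_tadpole)
  moreover have "gamma_SMB' (tadpole n k) = enat (nat \<lceil>log 2 (real n + real k + tadpole_sigma n)\<rceil>)"
    if nk: "even n" "odd k"
  proof -
    define L where "L = nat \<lceil>log 2 (real n)\<rceil>"
    have L: "L \<le> j \<longleftrightarrow> n \<le> 2 ^ j" for j
      unfolding L_def using n3 by (intro ceiling_log2_le_iff) auto
    have "L \<noteq> 0" using L[of 0] n3 by auto
    \<comment> \<open>\<open>2 ^ c\<close> is the least power of two that is at least
      \<open>n / 2\<close>.\<close>
    then obtain c where c: "L = Suc c" by (cases L) auto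
    have nc: "n \<le> 2 * 2 ^ c" using L[of L] c by simp
    have Pc: "2 ^ c \<le> (2 :: nat) ^ j" if "n \<le> 2 * 2 ^ j" for j
      using L[of "Suc j"] c that by simp
    \<comment> \<open>The bound for \<open>W a\<close> at \<open>a = 0\<close>. It equals the
      argument of the logarithm because \<open>tadpole_sigma n\<close> is
      \<open>2 ^ c - n / 2 + 1\<close>.\<close>
    define q where "q = n div 2 + 2 ^ c + (k - 0 + 1)"
    have "real n = 2 * real (n div 2)" using nk by auto
    then have q: "real n + real k + tadpole_sigma n = real q"
      unfolding tadpole_sigma_def L_def[symmetric] c q_def by (simp add: field_simps)
    have "win t (nbhds (W 0)) \<longleftrightarrow> q \<le> 2 ^ t" for t
    proof
      show "q \<le> 2 ^ t" if "win t (nbhds (W 0))"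
        unfolding q_def using nk Pc k1 that by (intro win_tadpole_imp_le) auto
      show "win t (nbhds (W 0))" if "q \<le> 2 ^ t"
        using nk nc k1 that unfolding q_def
        by (intro win_tadpole[of 0 c t]) (auto simp: nbhds_def)
    qed
    moreover have "0 < q" by (simp add: q_def)
    ultimately show ?thesis
      unfolding gamma_SMB'_def q
      by (intro SMB_number_eqI)
        (simp only: staller_wins_within_tadpole pos_simps ceiling_log2_le_iff)
  qed
  moreover have "gamma_SMB' (tadpole n k) = \<infinity>" if "\<not> (even n \<and> odd k)"
    unfolding gamma_SMB'_def using not_win_tadpole[OF that]
    by (intro SMB_number_infinity) (simp add: staller_wins_within_tadpole pos_simps)
  ultimately show ?thesis by auto
qed

end
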